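(* Let $r,n_1,\ldots,n_r,M,N$ be positive integers, let $n=n_1+\cdots+n_r$, and let $\varepsilon:[n]\to\{-1,1\}$ be a function. Let $X$ be the $M\times N$ random matrix with entries $\frac1{\sqrt N}f_{ij}$, where the $f_{ij}$ are independent real $N(0,1)$ random variables, and write $X^{(1)}=X$ and $X^{(-1)}=X^T$. Let $D_1,\ldots,D_n$ be arbitrary constant matrices of the sizes for which the following products are defined and square, and for $1\le k\le r$, with $s_0=0$ and $s_k=n_1+\cdots+n_k$, let $$Y_k=\mathrm{tr}\left(X^{(\varepsilon(s_{k-1}+1))}D_{s_{k-1}+1}X^{(\varepsilon(s_{k-1}+2))}D_{s_{k-1}+2}\cdots X^{(\varepsilon(s_k))}D_{s_k}\right).$$ With the permutations $\gamma_+,\gamma_-,\hat\pi$ and the notation $\gamma_-^{-1}\hat\pi\gamma_+/2$ and $\mathrm{Tr}_\sigma$ as defined in the context, $$\mathbb{E}(Y_1\cdots Y_r)=N^{-\frac n2-r}\sum_{\pi\in\mathcal{P}_2(n)}\mathrm{Tr}_{\gamma_-^{-1}\hat\pi\gamma_+/2}(D_1,\ldots,D_n).$$ (If $n$ is odd there are no pairings and both sides are $0$.)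
   Context: Notation: $[m]=\{1,\ldots,m\}$ and $[\pm m]=\{1,\ldots,m\}\cup\{-1,\ldots,-m\}$. $\mathrm{Tr}$ is the usual trace and $\mathrm{tr}:=\frac1N\mathrm{Tr}$ (always normalised by $N$). Matrices have real entries. $\mathcal{P}_2(n)$ is the set of pairings of $[n]$, i.e. partitions of $[n]$ into blocks of exactly two elements. A pairing $\pi$ is identified with the permutation of $[n]$ that swaps the two elements of each block; it is viewed as a permutation of $[\pm n]$ by letting it fix every negative integer. Permutations of $[\pm n]$ (composed right to left): $\delta(k)=-k$; $\delta'(k)=\varepsilon(|k|)k$; $\hat\pi:=\delta'\pi\delta\pi\delta'$; $\gamma_+$ is the permutation whose cycles on $[n]$ are $(s_{k-1}+1,s_{k-1}+2,\ldots,s_k)$ for $1\le k\le r$ and which fixes every negative integer; $\gamma_-$ is the permutation whose cycles on the negative integers are $(-(s_{k-1}+1),-(s_{k-1}+2),\ldots,-s_k)$ for $1\le k\le r$ and which fixes every positive integer. Size condition on the $D_k$: the number of rows of $D_k$ is the number of columns of $X^{(\varepsilon(k))}$ and the number of columns of $D_k$ is the number of rows of $X^{(\varepsilon(\gamma_+(k)))}$. The cycles of $\gamma_-^{-1}\hat\pi\gamma_+$ come in pairs of distinct cycles $(k_1,\ldots,k_m)$ and $(-k_m,\ldots,-k_1)$. A cycle is called particular if its element of lowest absolute value is positive. $\gamma_-^{-1}\hat\pi\gamma_+/2$ denotes the permutation consisting of the particular cycles of $\gamma_-^{-1}\hat\pi\gamma_+$ (including fixed points), acting on the set of integers appearing in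 these cycles. For a permutation $\sigma$ of a subset of $[\pm m]$ and matrices $A_1,\ldots,A_m$, write $A_k^{(1)}=A_k$ and $A_k^{(-1)}=A_k^T$, and define $$\mathrm{Tr}_\sigma(A_1,\ldots,A_m):=\prod_{(c_1,\ldots,c_l)}\mathrm{Tr}\left(A_{|c_1|}^{(\mathrm{sgn}(c_1))}\cdots A_{|c_l|}^{(\mathrm{sgn}(c_l))}\right),$$ the product being over all cycles $(c_1,\ldots,c_l)$ of $\sigma$, including fixed points. *)

theory Defs
  imports
    "HOL-Probability.Probability"
    "HOL-Combinatorics.Orbits"
    "HOL-Combinatorics.Cycles"
    "Jordan_Normal_Form.Matrix"
begin

section \<open>Matrices\<close>

definition mat_trace :: "real Matrix.mat \<Rightarrow> real"
  where "mat_trace A = (\<Sum>i<dim_row A. A $$ (i, i))"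

text \<open>The normalisation is by \<open>N\<close> for every square matrix, whatever its size.\<close>

definition norm_trace :: "nat \<Rightarrow> real Matrix.mat \<Rightarrow> real"
  where "norm_trace N A = mat_trace A / real N"

text \<open>Only products of nonempty lists occur; for the empty list there is no canonical size.\<close>

fun mat_prod :: "real Matrix.mat list \<Rightarrow> real Matrix.mat"
  where
    "mat_prod [A] = A"
  | "mat_prod (A # B # As) = A * mat_prod (B # As)"

text \<open>\<open>A\<^sup>(\<^sup>1\<^sup>) = A\<close> and \<open>A\<^sup>(\<^sup>-\<^sup>1\<^sup>) = A\<^sup>T\<close>; the sign is meant to be \<open>1\<close> or \<open>-1\<close>.\<close>

definition signed_mat :: "real Matrix.mat \<Rightarrow> int \<Rightarrow> real Matrix.mat"
  where "signed_mat A e = (if e = 1 then A else transpose_mat A)"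

text \<open>Number of rows and of columns of \<open>X\<^sup>(\<^sup>e\<^sup>)\<close> when \<open>X\<close> is \<open>M \<times> N\<close>.\<close>

definition signed_rows :: "nat \<Rightarrow> nat \<Rightarrow> int \<Rightarrow> nat"
  where "signed_rows M N e = (if e = 1 then M else N)"

definition signed_cols :: "nat \<Rightarrow> nat \<Rightarrow> int \<Rightarrow> nat"
  where "signed_cols M N e = (if e = 1 then N else M)"

lemma signed_mat_dims:
  assumes "A \<in> carrier_mat M N"
  shows "signed_mat A e \<in> carrier_mat (signed_rows M N e) (signed_cols M N e)"
  using assms by (auto simp: signed_mat_def signed_rows_def signed_cols_def)


section \<open>Permutations of \<open>[\<plusminus>n]\<close>\<close>

text \<open>
  \<open>[n]\<close> is the set of integers \<open>{1..int n}\<close>, and a permutation of \<open>[\<plusminus>n]\<close> is represented by a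
  function on the integers, of which only the values on \<open>[\<plusminus>n]\<close> matter (in particular, values at
  \<open>0\<close> and beyond \<open>\<plusminus>n\<close> play no role).
\<close>

definition pm_interval :: "nat \<Rightarrow> int set"
  where "pm_interval n = {1..int n} \<union> {- int n..-1}"

definition pairings :: "nat \<Rightarrow> int set set set"
  where "pairings n = {p. partition_on {1..int n} p \<and> (\<forall>B\<in>p. card B = 2)}"

definition pairing_perm :: "int set set \<Rightarrow> int \<Rightarrow> int"
  where "pairing_perm p k = (if k \<in> \<Union>p then THE l. l \<noteq> k \<and> {k, l} \<in> p else k)"

definition delta :: "int \<Rightarrow> int"
  where "delta k = - k"

definition delta' :: "(int \<Rightarrow> int) \<Rightarrow> int \<Rightarrow> int"
  where "delta' \<epsilon> k = \<epsilon> \<bar>k\<bar> * k"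

definition pi_hat :: "(int \<Rightarrow> int) \<Rightarrow> int set set \<Rightarrow> int \<Rightarrow> int"
  where "pi_hat \<epsilon> p =
    delta' \<epsilon> \<circ> pairing_perm p \<circ> delta \<circ> pairing_perm p \<circ> delta' \<epsilon>"

definition part_end :: "(nat \<Rightarrow> nat) \<Rightarrow> nat \<Rightarrow> int"
  where "part_end ns k = int (\<Sum>i=1..k. ns i)"

text \<open>The list \<open>s\<^bsub>k-1\<^esub> + 1, \<dots>, s\<^sub>k\<close>, where \<open>s = part_end ns\<close>.\<close>

definition part_list :: "(nat \<Rightarrow> nat) \<Rightarrow> nat \<Rightarrow> int list"
  where "part_list ns k = [part_end ns (k - 1) + 1..part_end ns k]"

definition gamma_plus :: "(nat \<Rightarrow> nat) \<Rightarrow> nat \<Rightarrow> int \<Rightarrow> int"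
  where "gamma_plus ns r =
    foldr (\<circ>) (map (\<lambda>k. cycle_of_list (part_list ns k)) [1..<Suc r]) id"

definition gamma_minus :: "(nat \<Rightarrow> nat) \<Rightarrow> nat \<Rightarrow> int \<Rightarrow> int"
  where "gamma_minus ns r =
    foldr (\<circ>) (map (\<lambda>k. cycle_of_list (map uminus (part_list ns k))) [1..<Suc r]) id"

text \<open>
  \<open>gamma_minus\<close> is a bijection of all integers, so its global inverse also inverts it on
  \<open>[\<plusminus>n]\<close>.
\<close>

definition kreweras_perm ::
    "(nat \<Rightarrow> nat) \<Rightarrow> nat \<Rightarrow> (int \<Rightarrow> int) \<Rightarrow> int set set \<Rightarrow> int \<Rightarrow> int"
  where "kreweras_perm ns r \<epsilon> p =
    inv_into UNIV (gamma_minus ns r) \<circ> pi_hat \<epsilon> p \<circ> gamma_plus ns r"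

definition particular :: "int set \<Rightarrow> bool"
  where "particular C \<longleftrightarrow> (\<exists>c\<in>C. c > 0 \<and> (\<forall>d\<in>C. \<bar>c\<bar> \<le> \<bar>d\<bar>))"

text \<open>
  For a permutation \<open>\<sigma>\<close> of \<open>[\<plusminus>n]\<close>, the permutation \<open>\<sigma>/2\<close> is \<open>half_perm n \<sigma>\<close> acting on the set
  \<open>half_dom n \<sigma>\<close>.
\<close>

definition half_dom :: "nat \<Rightarrow> (int \<Rightarrow> int) \<Rightarrow> int set"
  where "half_dom n \<sigma> = {k \<in> pm_interval n. particular (orbit \<sigma> k)}"

definition half_perm :: "nat \<Rightarrow> (int \<Rightarrow> int) \<Rightarrow> int \<Rightarrow> int"
  where "half_perm n \<sigma> = perm_restrict \<sigma> (half_dom n \<sigma>)"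


section \<open>Traces along permutations\<close>

text \<open>
  A cycle is written as the list \<open>c, \<sigma> c, \<sigma> (\<sigma> c), \<dots>\<close>, starting from an arbitrary element \<open>c\<close>;
  the choice is immaterial since traces are invariant under cyclic rotation of the factors.
\<close>

definition trace_perm :: "int set \<Rightarrow> (int \<Rightarrow> int) \<Rightarrow> (int \<Rightarrow> real Matrix.mat) \<Rightarrow> real"
  where "trace_perm S \<sigma> A =
    (\<Prod>C \<in> orbit \<sigma> ` S.
      mat_trace (mat_prod (map (\<lambda>c. signed_mat (A \<bar>c\<bar>) (sgn c))
        (support \<sigma> (SOME c. c \<in> C)))))"


section \<open>The random matrices\<close>

definition gauss_mat :: "nat \<Rightarrow> nat \<Rightarrow> (nat \<Rightarrow> nat \<Rightarrow> 'a \<Rightarrow> real) \<Rightarrow> 'a \<Rightarrow> real Matrix.mat"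
  where "gauss_mat M N f \<omega> = Matrix.mat M N (\<lambda>(i, j). 1 / sqrt (real N) * f i j \<omega>)"

text \<open>The random variable \<open>Y\<^sub>k\<close>, for \<open>D\<close> and \<open>\<epsilon>\<close> indexed by \<open>{1..n}\<close>.\<close>

definition word_trace ::
    "nat \<Rightarrow> (nat \<Rightarrow> nat) \<Rightarrow> (int \<Rightarrow> int) \<Rightarrow> (int \<Rightarrow> real Matrix.mat) \<Rightarrow> ('a \<Rightarrow> real Matrix.mat)
      \<Rightarrow> nat \<Rightarrow> 'a \<Rightarrow> real"
  where "word_trace N ns \<epsilon> D X k \<omega> =
    norm_trace N (mat_prod (concat (map (\<lambda>j. [signed_mat (X \<omega>) (\<epsilon> j), D j]) (part_list ns k))))"

end

theory Submission
  imports Defs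
begin

text \<open>
  Both sides are sums over index assignments \<open>i\<close> on \<open>[\<plusminus>n]\<close>. Writing \<open>i k\<close> and \<open>i (- k)\<close> for the two
  indices of the \<open>k\<close>-th random factor, the product of the traces is
  \<open>\<Sum>\<^sub>i \<Prod>\<^sub>k X\<^sup>(\<^sup>\<epsilon>\<^sup>k\<^sup>)(i k, i (- k)) D\<^sub>k(i (- k), i (\<gamma>\<^sub>+ k))\<close> (lemma \<open>word_traces_expand\<close>). Up to the factor
  \<open>1 / sqrt N\<close>, the \<open>k\<close>-th random factor is the Gaussian entry with row \<open>i (\<delta>' k)\<close> and column
  \<open>i (- \<delta>' k)\<close>, so Wick's formula (\<open>gaussian_wick\<close>) turns the expectation into a sum over pairings
  \<open>p\<close>, in which an assignment \<open>i\<close> survives precisely if paired factors select the same entry.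

  That condition says that \<open>i\<close> is invariant under the involution \<open>\<rho> x = pi_hat \<epsilon> p (- x)\<close>
  (\<open>monochromatic_iff_glued\<close>). It remains to sum \<open>\<Prod>\<^sub>k D\<^sub>k(i (- k), i (\<gamma>\<^sub>+ k))\<close> over the \<open>\<rho>\<close>-invariant
  \<open>i\<close>. For \<open>c\<close> in \<open>[\<plusminus>n]\<close>, the matrix \<open>D\<close> with label \<open>\<bar>c\<bar>\<close>, transposed if \<open>c < 0\<close>, has its row index at
  position \<open>- \<gamma>\<^sub>- c\<close> and its column index at position \<open>\<gamma>\<^sub>+ c\<close>, and \<open>\<rho>\<close> exchanges \<open>\<gamma>\<^sub>+ c\<close> with \<open>- \<gamma>\<^sub>- (K c)\<close>,
  where \<open>K\<close> is the permutation \<open>\<gamma>\<^sub>-\<^sup>-\<^sup>1 pi_hat \<gamma>\<^sub>+\<close>. So invariance means that the factors multiply as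
  matrices along the cycles of \<open>K\<close>. Each \<open>D\<^sub>k\<close> would then appear twice, as \<open>c = k\<close> and as \<open>c = - k\<close>;
  since negation sends each cycle of \<open>K\<close> to a different one (locale \<open>reflected_perm\<close>), keeping the
  particular cycles selects every factor once, and the positions \<open>- \<gamma>\<^sub>- c\<close> with \<open>c\<close> in these cycles
  form a transversal of the orbits of \<open>\<rho>\<close>. The sum is therefore the trace of the \<open>D\<^sub>k\<close> along the halved
  permutation (\<open>trace_half\<close>).
\<close>

section \<open>Sums over index assignments\<close>

lemma sum_PiE_Un:
  fixes F :: "('b \<Rightarrow> 'c) \<Rightarrow> real"
  assumes disj: "S \<inter> T = {}"
  shows "(\<Sum>j\<in>PiE (S \<union> T) B. F j)
    = (\<Sum>g\<in>PiE S B. \<Sum>h\<in>PiE T B. F (\<lambda>x. if x \<in> S then g x else h x))"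
proof -
  have "(\<Sum>j\<in>PiE (S \<union> T) B. F j)
    = (\<Sum>(g, h)\<in>PiE S B \<times> PiE T B. F (\<lambda>x. if x \<in> S then g x else h x))"
  proof (rule sum.reindex_bij_witness
      [where i = "\<lambda>(g, h) x. if x \<in> S then g x else h x"
        and j = "\<lambda>j. (restrict j S, restrict j T)"])
    fix j assume "j \<in> PiE (S \<union> T) B"
    then show "(case (restrict j S, restrict j T) of (g, h) \<Rightarrow> \<lambda>x. if x \<in> S then g x else h x) = j"
      by (auto simp: fun_eq_iff PiE_def extensional_def)
    then show "(case (restrict j S, restrict j T) of (g, h) \<Rightarrow> F (\<lambda>x. if x \<in> S then g x else h x)) = F j"
      by simp
  qed (use disj in \<open>auto simp: fun_eq_iff PiE_def extensional_def Pi_def\<close>)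
  then show ?thesis
    by (simp add: sum.cartesian_product)
qed

text \<open>
  A product of weights along a map preserving the blocks \<open>C k\<close> only couples indices within
  one block, so the sum over all index assignments factorises.
\<close>

lemma sum_PiE_blocks:
  fixes w :: "'b \<Rightarrow> 'c \<Rightarrow> 'c \<Rightarrow> real"
  assumes "finite I"
    and fin: "\<And>k. k \<in> I \<Longrightarrow> finite (C k)"
    and disj: "\<And>k l. k \<in> I \<Longrightarrow> l \<in> I \<Longrightarrow> k \<noteq> l \<Longrightarrow> C k \<inter> C l = {}"
    and \<sigma>: "\<And>k c. k \<in> I \<Longrightarrow> c \<in> C k \<Longrightarrow> \<sigma> c \<in> C k"
  shows "(\<Prod>k\<in>I. \<Sum>j\<in>PiE (C k) B. \<Prod>c\<in>C k. w c (j c) (j (\<sigma> c)))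
    = (\<Sum>j\<in>PiE (\<Union>k\<in>I. C k) B. \<Prod>c\<in>(\<Union>k\<in>I. C k). w c (j c) (j (\<sigma> c)))"
  using assms
proof (induction I rule: finite_induct)
  case empty
  then show ?case by simp
next
  case (insert k I)
  let ?U = "\<Union>l\<in>I. C l"
  let ?w = "\<lambda>S j. \<Prod>c\<in>S. w c (j c) (j (\<sigma> c))"
  have D: "C k \<inter> ?U = {}"
    using insert.prems(2) insert.hyps by fastforce
  have finU: "finite ?U" "finite (C k)"
    using insert.prems(1) insert.hyps by auto
  have closed: "\<sigma> c \<in> C k" if "c \<in> C k" for c
    using insert.prems(3) that by blast
  have closedU: "\<sigma> c \<in> ?U" if "c \<in> ?U" for c
    using insert.prems(3) that by blast
  have "(\<Sum>j\<in>PiE (\<Union>l\<in>insert k I. C l) B. ?w (\<Union>l\<in>insert k I. C l) j)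
    = (\<Sum>j\<in>PiE (C k \<union> ?U) B. ?w (C k) j * ?w ?U j)"
    using D finU by (simp add: prod.union_disjoint)
  also have "\<dots> = (\<Sum>g\<in>PiE (C k) B. \<Sum>h\<in>PiE ?U B. ?w (C k) g * ?w ?U h)"
  proof (subst sum_PiE_Un[OF D], intro sum.cong refl arg_cong2[where f = "(*)"] prod.cong)
    fix g h c assume "c \<in> C k"
    then show "w c (if c \<in> C k then g c else h c) (if \<sigma> c \<in> C k then g (\<sigma> c) else h (\<sigma> c)) = w c (g c) (g (\<sigma> c))"
      using closed by simp
  next
    fix g h c assume c: "c \<in> ?U"
    then have "c \<notin> C k" "\<sigma> c \<notin> C k"
      using closedU[of c] D by blast+
    then show "w c (if c \<in> C k then g c else h c) (if \<sigma> c \<in> C k then g (\<sigma> c) else h (\<sigma> c)) = w c (h c) (h (\<sigma> c))"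
      by simp
  qed
  also have "\<dots> = (\<Sum>g\<in>PiE (C k) B. ?w (C k) g) * (\<Sum>h\<in>PiE ?U B. ?w ?U h)"
    by (simp add: sum_product)
  also have "\<dots> = (\<Prod>l\<in>insert k I. \<Sum>j\<in>PiE (C l) B. ?w (C l) j)"
    using insert by simp
  finally show ?case ..
qed

text \<open>
  Assignments on \<open>Q\<close> that are constant on the orbits of an involution are determined by their
  values on a transversal, here parametrised by \<open>\<theta>\<close>.
\<close>

lemma sum_invariant_assignments:
  fixes F :: "('b \<Rightarrow> 'c) \<Rightarrow> real"
  assumes inj: "inj_on \<theta> H"
    and Q: "Q = \<theta> ` H \<union> \<rho> ` \<theta> ` H" and disj: "\<theta> ` H \<inter> \<rho> ` \<theta> ` H = {}"
    and inv: "\<And>x. x \<in> Q \<Longrightarrow> \<rho> (\<rho> x) = x"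
    and B: "\<And>x. x \<in> Q \<Longrightarrow> B (\<rho> x) = B x"
  shows "(\<Sum>i | i \<in> PiE Q B \<and> (\<forall>x\<in>Q. i (\<rho> x) = i x). F (\<lambda>c\<in>H. i (\<theta> c)))
    = (\<Sum>j\<in>PiE H (\<lambda>c. B (\<theta> c)). F j)"
proof (rule sum.reindex_bij_witness
    [where j = "\<lambda>i. \<lambda>c\<in>H. i (\<theta> c)"
      and i = "\<lambda>j. \<lambda>x\<in>Q. j (the_inv_into H \<theta> (if x \<in> \<theta> ` H then x else \<rho> x))"])
  have inv\<theta>: "the_inv_into H \<theta> (\<theta> c) = c" if "c \<in> H" for c
    by (rule the_inv_into_f_f[OF inj that])
  have \<theta>Q: "\<theta> c \<in> Q" "\<rho> (\<theta> c) \<in> Q" "\<rho> (\<rho> (\<theta> c)) = \<theta> c" "\<rho> (\<theta> c) \<notin> \<theta> ` H" if "c \<in> H" for c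
    using that inv Q disj by auto
  have casesQ: "(\<exists>c\<in>H. x = \<theta> c) \<or> (\<exists>c\<in>H. x = \<rho> (\<theta> c))" if "x \<in> Q" for x
    using that Q by auto
  {
    fix i assume i: "i \<in> {i \<in> PiE Q B. \<forall>x\<in>Q. i (\<rho> x) = i x}"
    show "(\<lambda>x\<in>Q. (\<lambda>c\<in>H. i (\<theta> c)) (the_inv_into H \<theta> (if x \<in> \<theta> ` H then x else \<rho> x))) = i"
    proof
      fix x
      show "(\<lambda>x\<in>Q. (\<lambda>c\<in>H. i (\<theta> c)) (the_inv_into H \<theta> (if x \<in> \<theta> ` H then x else \<rho> x))) x = i x"
      proof (cases "x \<in> Q")
        case True
        from casesQ[OF this] show ?thesis
          using i \<theta>Q inv\<theta> True by auto
      qed (use i in \<open>auto simp: PiE_def extensional_def\<close>)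
    qed
    show "(\<lambda>c\<in>H. i (\<theta> c)) \<in> PiE H (\<lambda>c. B (\<theta> c))"
      using i \<theta>Q by auto
    show "F (\<lambda>c\<in>H. i (\<theta> c)) = F (\<lambda>c\<in>H. i (\<theta> c))" ..
  next
    fix j assume j: "j \<in> PiE H (\<lambda>c. B (\<theta> c))"
    define i where "i = (\<lambda>x\<in>Q. j (the_inv_into H \<theta> (if x \<in> \<theta> ` H then x else \<rho> x)))"
    have i1: "i (\<theta> c) = j c" and i2: "i (\<rho> (\<theta> c)) = j c" if "c \<in> H" for c
      using \<theta>Q[OF that] inv\<theta>[OF that] that by (auto simp: i_def)
    show "(\<lambda>c\<in>H. i (\<theta> c)) = j"
      using i1 j by (auto simp: fun_eq_iff PiE_def extensional_def)
    have "i x \<in> B x \<and> i (\<rho> x) = i x" if "x \<in> Q" for x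
      using casesQ[OF that] i1 i2 j \<theta>Q B by fastforce
    moreover have "i \<in> extensional Q"
      by (simp add: i_def)
    ultimately show "i \<in> {i \<in> PiE Q B. \<forall>x\<in>Q. i (\<rho> x) = i x}"
      by (simp add: PiE_def)
  }
qed

section \<open>Traces of products along cycles\<close>

fun path_weight :: "('b \<Rightarrow> real Matrix.mat) \<Rightarrow> ('b \<Rightarrow> nat) \<Rightarrow> nat \<Rightarrow> nat \<Rightarrow> 'b list \<Rightarrow> real"
  where
    "path_weight A j a b [] = 1"
  | "path_weight A j a b [x] = A x $$ (a, b)"
  | "path_weight A j a b (x # y # ys) = A x $$ (a, j y) * path_weight A j (j y) b (y # ys)"

lemma path_weight_cong:
  "(\<And>y. y \<in> set (tl xs) \<Longrightarrow> j y = j' y) \<Longrightarrow> path_weight A j a b xs = path_weight A j' a b xs"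
  by (induction A j a b xs rule: path_weight.induct) auto

lemma sum_PiE_insert:
  fixes F :: "('b \<Rightarrow> 'c) \<Rightarrow> real"
  assumes "x \<notin> S"
  shows "(\<Sum>j\<in>PiE (insert x S) B. F j) = (\<Sum>m\<in>B x. \<Sum>h\<in>PiE S B. F (h(x := m)))"
proof -
  have "(\<Sum>j\<in>PiE ({x} \<union> S) B. F j)
      = (\<Sum>g\<in>PiE {x} B. \<Sum>h\<in>PiE S B. F (\<lambda>y. if y \<in> {x} then g y else h y))"
    using assms by (intro sum_PiE_Un) auto
  also have "\<dots> = (\<Sum>m\<in>B x. \<Sum>h\<in>PiE S B. F (h(x := m)))"
    by (rule sum.reindex_bij_witness[where j = "\<lambda>g. g x" and i = "\<lambda>m. \<lambda>y\<in>{x}. m"])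
      (auto simp: fun_eq_iff PiE_def extensional_def fun_upd_def intro!: sum.cong arg_cong[where f = F])
  finally show ?thesis by simp
qed

text \<open>
  The outer indices \<open>a\<close> and \<open>b\<close> are kept apart from the summed ones; the trace later identifies both
  with the index at the first point of the cycle.
\<close>

lemma mat_prod_entry:
  assumes "xs \<noteq> []" "distinct xs"
    and "\<And>x. x \<in> set xs \<Longrightarrow> dim_row (A x) = d x"
    and "successively (\<lambda>x y. dim_col (A x) = d y) xs"
  shows "dim_row (mat_prod (map A xs)) = d (hd xs)
    \<and> dim_col (mat_prod (map A xs)) = dim_col (A (last xs))
    \<and> (\<forall>a b. a < d (hd xs) \<longrightarrow> b < dim_col (A (last xs)) \<longrightarrow>
        mat_prod (map A xs) $$ (a, b)
          = (\<Sum>j\<in>PiE (set (tl xs)) (\<lambda>c. {..<d c}). path_weight A j a b xs))"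
  using assms
proof (induction xs rule: induct_list012)
  case (3 x y zs)
  let ?M = "mat_prod (map A (y # zs))"
  have IH: "dim_row ?M = d y" "dim_col ?M = dim_col (A (last (y # zs)))"
    and IHe: "\<And>a b. a < d y \<Longrightarrow> b < dim_col (A (last (y # zs))) \<Longrightarrow> ?M $$ (a, b)
          = (\<Sum>j\<in>PiE (set zs) (\<lambda>c. {..<d c}). path_weight A j a b (y # zs))"
    using "3.IH"(2) "3.prems" by auto
  have dims: "dim_row (A x) = d x" "dim_col (A x) = d y"
    using "3.prems" by auto
  have y: "y \<notin> set zs" using "3.prems" by simp
  have "(A x * ?M) $$ (a, b)
      = (\<Sum>j\<in>PiE (set (y # zs)) (\<lambda>c. {..<d c}). path_weight A j a b (x # y # zs))"
    if a: "a < d x" and b: "b < dim_col (A (last (y # zs)))" for a b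
  proof -
    have "(A x * ?M) $$ (a, b) = (\<Sum>m<d y. A x $$ (a, m) * ?M $$ (m, b))"
      using a b dims IH by (simp add: scalar_prod_def atLeast0LessThan)
    also have "\<dots> = (\<Sum>m<d y. \<Sum>j\<in>PiE (set zs) (\<lambda>c. {..<d c}).
        A x $$ (a, m) * path_weight A j m b (y # zs))"
      by (intro sum.cong refl) (simp only: IHe[OF _ b] lessThan_iff sum_distrib_left)
    also have "\<dots> = (\<Sum>m<d y. \<Sum>j\<in>PiE (set zs) (\<lambda>c. {..<d c}).
        path_weight A (j(y := m)) a b (x # y # zs))"
    proof (intro sum.cong refl)
      fix m j
      have "path_weight A j m b (y # zs) = path_weight A (j(y := m)) m b (y # zs)"
        using y by (intro path_weight_cong) auto
      then show "A x $$ (a, m) * path_weight A j m b (y # zs)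
          = path_weight A (j(y := m)) a b (x # y # zs)"
        by simp
    qed
    also have "\<dots> = (\<Sum>j\<in>PiE (set (y # zs)) (\<lambda>c. {..<d c}). path_weight A j a b (x # y # zs))"
      unfolding list.set sum_PiE_insert[OF y] ..
    finally show ?thesis .
  qed
  then show ?case
    using IH dims by simp
qed (auto simp: PiE_empty_domain)

lemma path_weight_cycle:
  assumes "xs \<noteq> []" "distinct xs" "successively (\<lambda>x y. \<sigma> x = y) xs"
  shows "path_weight A j (j (hd xs)) (j (\<sigma> (last xs))) xs = (\<Prod>c\<in>set xs. A c $$ (j c, j (\<sigma> c)))"
  using assms by (induction xs rule: induct_list012) auto

text \<open>
  Expanding the matrix product, the trace attaches a summation index to each point of the cycle;
  the factor at \<open>c\<close> couples the index at \<open>c\<close> with the index at the next point \<open>\<sigma> c\<close>.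
\<close>

lemma trace_mat_prod_cycle:
  assumes xs: "xs \<noteq> []" "distinct xs" "successively (\<lambda>x y. \<sigma> x = y) xs" "\<sigma> (last xs) = hd xs"
    and A: "\<And>c. c \<in> set xs \<Longrightarrow> A c \<in> carrier_mat (d c) (d (\<sigma> c))"
  shows "mat_trace (mat_prod (map A xs))
    = (\<Sum>j\<in>PiE (set xs) (\<lambda>c. {..<d c}). \<Prod>c\<in>set xs. A c $$ (j c, j (\<sigma> c)))"
proof -
  have rows: "\<And>x. x \<in> set xs \<Longrightarrow> dim_row (A x) = d x"
    using A by auto
  have "successively (\<lambda>x y. dim_col (A x) = d y) xs"
    by (rule successively_mono[OF xs(3)]) (use A in auto)
  note E = mat_prod_entry[OF xs(1,2) rows this]
  have last: "dim_col (A (last xs)) = d (hd xs)"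
    using A[of "last xs"] xs by auto
  obtain x ys where xy: "xs = x # ys"
    using xs(1) by (cases xs) auto
  have x: "x \<notin> set ys" using xs xy by auto
  have "mat_trace (mat_prod (map A xs)) = (\<Sum>a<d x. mat_prod (map A xs) $$ (a, a))"
    using E by (simp add: mat_trace_def xy)
  also have "\<dots> = (\<Sum>a<d x. \<Sum>j\<in>PiE (set ys) (\<lambda>c. {..<d c}). path_weight A j a a xs)"
    using E last by (simp add: xy)
  also have "\<dots> = (\<Sum>a<d x. \<Sum>j\<in>PiE (set ys) (\<lambda>c. {..<d c}).
      path_weight A (j(x := a)) ((j(x := a)) x) ((j(x := a)) x) xs)"
    using x by (intro sum.cong refl) (auto simp: xy intro!: path_weight_cong)
  also have "\<dots> = (\<Sum>j\<in>PiE (set xs) (\<lambda>c. {..<d c}). path_weight A j (j x) (j x) xs)"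
    unfolding xy by (simp add: sum_PiE_insert[OF x])
  also have "\<dots> = (\<Sum>j\<in>PiE (set xs) (\<lambda>c. {..<d c}). \<Prod>c\<in>set xs. A c $$ (j c, j (\<sigma> c)))"
    using path_weight_cycle[OF xs(1-3)] xs(4) by (simp add: xy)
  finally show ?thesis .
qed

lemma support_cycle:
  assumes "permutation \<sigma>"
  shows "support \<sigma> c \<noteq> []" "distinct (support \<sigma> c)" "successively (\<lambda>x y. \<sigma> x = y) (support \<sigma> c)"
    "\<sigma> (last (support \<sigma> c)) = hd (support \<sigma> c)" "set (support \<sigma> c) = orbit \<sigma> c"
proof -
  note l = least_power_of_permutation[OF assms, of c]
  show ne: "support \<sigma> c \<noteq> []" using l(2) by simp
  show "distinct (support \<sigma> c)" by (rule cycle_of_permutation[OF assms])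
  show "successively (\<lambda>x y. \<sigma> x = y) (support \<sigma> c)"
    by (auto simp: successively_conv_nth)
  have "last (support \<sigma> c) = (\<sigma> ^^ (least_power \<sigma> c - 1)) c"
    using l(2) ne by (simp add: last_map)
  then have "\<sigma> (last (support \<sigma> c)) = (\<sigma> ^^ least_power \<sigma> c) c"
    using l(2) by (cases "least_power \<sigma> c") auto
  also have "\<dots> = hd (support \<sigma> c)"
    using l ne by (simp add: hd_map)
  finally show "\<sigma> (last (support \<sigma> c)) = hd (support \<sigma> c)" .
  show "set (support \<sigma> c) = orbit \<sigma> c"
    by (subst support_set[OF assms], subst orbit_altdef_permutation[OF assms]) auto
qed

text \<open>
  This is the form in which traces along permutations enter the proof: any set of labelled indices
  that is permuted by \<open>\<sigma>\<close> may be summed at once, without reference to the individual cycles or to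
  their starting points.
\<close>

lemma trace_perm_eq_sum:
  assumes S: "finite S" and \<sigma>: "\<sigma> permutes S"
    and A: "\<And>c. c \<in> S \<Longrightarrow> signed_mat (A \<bar>c\<bar>) (sgn c) \<in> carrier_mat (d c) (d (\<sigma> c))"
  shows "trace_perm S \<sigma> A
    = (\<Sum>j\<in>PiE S (\<lambda>c. {..<d c}). \<Prod>c\<in>S. signed_mat (A \<bar>c\<bar>) (sgn c) $$ (j c, j (\<sigma> c)))"
proof -
  let ?A = "\<lambda>c. signed_mat (A \<bar>c\<bar>) (sgn c)"
  have perm: "permutation \<sigma>"
    using S \<sigma> permutation_permutes by blast
  have sub: "C \<subseteq> S" if "C \<in> orbit \<sigma> ` S" for C
    using that permutes_orbit_subset[OF \<sigma>] by auto
  have U: "\<Union> (orbit \<sigma> ` S) = S"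
    using sub permutation_self_in_orbit[OF perm] by blast
  have cyc: "cyclic_on \<sigma> C" if "C \<in> orbit \<sigma> ` S" for C
    using that cyclic_on_orbit'[OF perm] by auto
  have tr: "mat_trace (mat_prod (map ?A (support \<sigma> (SOME c. c \<in> C))))
      = (\<Sum>j\<in>PiE C (\<lambda>c. {..<d c}). \<Prod>c\<in>C. ?A c $$ (j c, j (\<sigma> c)))" if C: "C \<in> orbit \<sigma> ` S" for C
  proof -
    have "(SOME c. c \<in> C) \<in> C"
      using C permutation_self_in_orbit[OF perm] by (metis imageE someI_ex)
    then have "orbit \<sigma> (SOME c. c \<in> C) = C"
      using orbit_cyclic_eq3[OF cyc[OF C]] by blast
    then have set: "set (support \<sigma> (SOME c. c \<in> C)) = C"
      using support_cycle(5)[OF perm] by simp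
    have "mat_trace (mat_prod (map ?A (support \<sigma> (SOME c. c \<in> C))))
      = (\<Sum>j\<in>PiE (set (support \<sigma> (SOME c. c \<in> C))) (\<lambda>c. {..<d c}).
          \<Prod>c\<in>set (support \<sigma> (SOME c. c \<in> C)). ?A c $$ (j c, j (\<sigma> c)))"
      by (rule trace_mat_prod_cycle[OF support_cycle(1-4)[OF perm]])
        (use A sub[OF C] set in blast)
    then show ?thesis
      by (simp only: set)
  qed
  have "trace_perm S \<sigma> A
      = (\<Prod>C\<in>orbit \<sigma> ` S. \<Sum>j\<in>PiE C (\<lambda>c. {..<d c}). \<Prod>c\<in>C. ?A c $$ (j c, j (\<sigma> c)))"
    unfolding trace_perm_def by (intro prod.cong refl tr)
  also have "\<dots> = (\<Sum>j\<in>PiE (\<Union>C\<in>orbit \<sigma> ` S. C) (\<lambda>c. {..<d c}).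
      \<Prod>c\<in>(\<Union>C\<in>orbit \<sigma> ` S. C). ?A c $$ (j c, j (\<sigma> c)))"
  proof (rule sum_PiE_blocks)
    show "finite (orbit \<sigma> ` S)" using S by simp
    show "finite C" if "C \<in> orbit \<sigma> ` S" for C
      using finite_cyclic_on[OF cyc[OF that]] .
    show "C \<inter> C' = {}" if "C \<in> orbit \<sigma> ` S" "C' \<in> orbit \<sigma> ` S" "C \<noteq> C'" for C C'
      using orbit_cyclic_eq3[OF cyc[OF that(1)]] orbit_cyclic_eq3[OF cyc[OF that(2)]] that(3) by blast
    show "\<sigma> c \<in> C" if "C \<in> orbit \<sigma> ` S" "c \<in> C" for C c
      using cyclic_on_inI[OF cyc] that by blast
  qed
  finally show ?thesis
    using U by simp
qed

section \<open>Gaussian moments and pairings\<close>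

text \<open>
  Pairings of an arbitrary set rather than of an interval: the induction below removes blocks, and
  what remains of an interval is usually not an interval.
\<close>

definition pairings_of :: "'b set \<Rightarrow> 'b set set set"
  where "pairings_of S = {p. partition_on S p \<and> (\<forall>B\<in>p. card B = 2)}"

lemma finite_pairings_of: "finite S \<Longrightarrow> finite (pairings_of S)"
  unfolding pairings_of_def
  by (rule finite_subset[of _ "Pow (Pow S)"]) (auto simp: partition_on_def)

lemma pairings_of_empty: "pairings_of {} = {{}}"
  by (auto simp: pairings_of_def partition_on_empty)

lemma pairing_partner:
  assumes p: "p \<in> pairings_of S" and x: "x \<in> S"
  obtains y where "y \<in> S" "y \<noteq> x" "{x, y} \<in> p" "\<And>z. z \<noteq> x \<Longrightarrow> {x, z} \<in> p \<Longrightarrow> z = y"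
proof -
  have part: "partition_on S p" and two: "\<And>B. B \<in> p \<Longrightarrow> card B = 2"
    using p by (auto simp: pairings_of_def)
  obtain B where B: "B \<in> p" "x \<in> B"
    using part x by (auto simp: partition_on_def)
  obtain u v where uv: "B = {u, v}" "u \<noteq> v"
    using two[OF B(1)] by (auto simp: card_2_iff)
  define y where "y = (if x = u then v else u)"
  have y: "B = {x, y}" "y \<noteq> x"
    using uv B(2) by (auto simp: y_def)
  have "z = y" if "z \<noteq> x" "{x, z} \<in> p" for z
  proof -
    have "{x, z} = B"
      using disjointD[OF partition_onD2[OF part] that(2) B(1)] B(2) by blast
    then show ?thesis using that(1) y by (metis doubleton_eq_iff)
  qed
  moreover have "y \<in> S"
    using part B(1) y by (auto simp: partition_on_def)
  ultimately show thesis
    using that y B(1) by blast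
qed

lemma pairings_of_remove:
  assumes "p \<in> pairings_of S" "{x, y} \<in> p"
  shows "p - {{x, y}} \<in> pairings_of (S - {x, y})"
proof -
  have disj: "B \<inter> {x, y} = {}" if "B \<in> p - {{x, y}}" for B
    using disjointD[of p B "{x, y}"] assms that by (auto simp: pairings_of_def partition_on_def)
  have "\<Union> (p - {{x, y}}) = S - {x, y}"
  proof
    show "\<Union> (p - {{x, y}}) \<subseteq> S - {x, y}"
      using disj assms by (auto simp: pairings_of_def partition_on_def)
    show "S - {x, y} \<subseteq> \<Union> (p - {{x, y}})"
      using assms by (auto simp: pairings_of_def partition_on_def)
  qed
  moreover have "disjoint (p - {{x, y}})"
    using assms(1) by (auto simp: pairings_of_def partition_on_def intro: pairwise_subset)
  ultimately show ?thesis
    using assms(1) by (simp add: pairings_of_def partition_on_def)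
qed

lemma pairings_of_insert:
  assumes "q \<in> pairings_of S" "x \<notin> S" "y \<notin> S" "x \<noteq> y"
  shows "insert {x, y} q \<in> pairings_of (insert x (insert y S))" "{x, y} \<notin> q"
proof -
  have U: "\<Union> q = S" and dis: "disjoint q" and ne: "{} \<notin> q" and two: "\<forall>B\<in>q. card B = 2"
    using assms(1) by (auto simp: pairings_of_def partition_on_def)
  show "{x, y} \<notin> q"
    using U assms(2) by auto
  have "disjoint (insert {x, y} q)"
    using dis U assms(2,3) unfolding disjoint_def by blast
  then show "insert {x, y} q \<in> pairings_of (insert x (insert y S))"
    using U ne two assms(4) by (simp add: pairings_of_def partition_on_def)
qed

text \<open>
  A pairing of \<open>insert x S\<close> is the choice of a partner for \<open>x\<close> together with a pairing of the
  remaining points. This mirrors the recursion for Gaussian moments below.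
\<close>

lemma sum_pairings_of_insert:
  fixes F :: "'b set set \<Rightarrow> real"
  assumes "finite S" "x \<notin> S"
  shows "(\<Sum>p\<in>pairings_of (insert x S). F p)
    = (\<Sum>y\<in>S. \<Sum>q\<in>pairings_of (S - {y}). F (insert {x, y} q))"
proof -
  let ?y = "\<lambda>p. THE y. y \<noteq> x \<and> {x, y} \<in> p"
  have "(\<Sum>p\<in>pairings_of (insert x S). F p)
    = (\<Sum>(y, q)\<in>(SIGMA y:S. pairings_of (S - {y})). F (insert {x, y} q))"
  proof (rule sum.reindex_bij_witness
      [where j = "\<lambda>p. (?y p, p - {{x, ?y p}})" and i = "\<lambda>(y, q). insert {x, y} q"])
    fix p assume p: "p \<in> pairings_of (insert x S)"
    obtain y where y: "y \<in> insert x S" "y \<noteq> x" "{x, y} \<in> p"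
      and uniq: "\<And>z. z \<noteq> x \<Longrightarrow> {x, z} \<in> p \<Longrightarrow> z = y"
      using pairing_partner[OF p, of x] by blast
    have the: "?y p = y"
      by (rule the_equality) (use y uniq in blast)+
    have "insert x S - {x, y} = S - {y}"
      using assms by auto
    then show "(?y p, p - {{x, ?y p}}) \<in> (SIGMA y:S. pairings_of (S - {y}))"
      using pairings_of_remove[OF p y(3)] y unfolding the by auto
    show "(case (?y p, p - {{x, ?y p}}) of (y, q) \<Rightarrow> insert {x, y} q) = p"
      using y unfolding the by auto
    then show "(case (?y p, p - {{x, ?y p}}) of (y, q) \<Rightarrow> F (insert {x, y} q)) = F p"
      by auto
  next
    fix yq assume yq: "yq \<in> (SIGMA y:S. pairings_of (S - {y}))"
    obtain y q where yq': "yq = (y, q)" "y \<in> S" "q \<in> pairings_of (S - {y})"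
      using yq by auto
    have "y \<noteq> x" using yq' assms by auto
    have ins: "insert {x, y} q \<in> pairings_of (insert x S)" "{x, y} \<notin> q"
      using pairings_of_insert[OF yq'(3), of x y] assms yq'(2) by (auto simp: insert_absorb)
    obtain z where z: "\<And>w. w \<noteq> x \<Longrightarrow> {x, w} \<in> insert {x, y} q \<Longrightarrow> w = z"
      using pairing_partner[OF ins(1), of x] by blast
    have "?y (insert {x, y} q) = y"
      using z[of y] z \<open>y \<noteq> x\<close> by (intro the_equality) blast+
    then show "(?y (case yq of (y, q) \<Rightarrow> insert {x, y} q),
        (case yq of (y, q) \<Rightarrow> insert {x, y} q) - {{x, ?y (case yq of (y, q) \<Rightarrow> insert {x, y} q)}}) = yq"
      using ins(2) by (simp add: yq')
    show "(case yq of (y, q) \<Rightarrow> insert {x, y} q) \<in> pairings_of (insert x S)"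
      using ins(1) by (simp add: yq')
  qed
  also have "\<dots> = (\<Sum>y\<in>S. \<Sum>q\<in>pairings_of (S - {y}). F (insert {x, y} q))"
    using assms(1) by (subst sum.Sigma) (auto intro!: finite_pairings_of)
  finally show ?thesis .
qed

definition normal_moment :: "nat \<Rightarrow> real"
  where "normal_moment m = (\<integral>x. std_normal_density x * x ^ m \<partial>lborel)"

lemma normal_moment_0: "normal_moment 0 = 1"
  using integral_std_normal_moment_even[of 0] by (simp add: normal_moment_def)

text \<open>
  Gaussian integration by parts for monomials. It includes \<open>t = 0\<close>, where the truncated \<open>t - 1\<close> is
  harmless because of the factor \<open>t\<close>.
\<close>

lemma normal_moment_Suc: "normal_moment (Suc t) = real t * normal_moment (t - 1)"
proof (cases "even t")
  case True
  then obtain k where k: "t = 2 * k" by blast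
  have "normal_moment (Suc t) = 0"
    using integral_std_normal_moment_odd[of k] by (simp add: normal_moment_def k)
  moreover have "normal_moment (t - 1) = 0" if "k > 0"
    using integral_std_normal_moment_odd[of "k - 1"] that
    by (cases k) (simp_all add: normal_moment_def k)
  ultimately show ?thesis
    by (cases "k = 0") (auto simp: k)
next
  case False
  then obtain k where k: "t = 2 * k + 1" using oddE by blast
  have "normal_moment (Suc t) = fact (2 * Suc k) / (2 ^ Suc k * fact (Suc k))"
    using integral_std_normal_moment_even[of "Suc k"] by (simp add: normal_moment_def k)
  also have "\<dots> = real t * (fact (2 * k) / (2 ^ k * fact k))"
  proof -
    have "(fact (2 * Suc k) :: real) = real (2 * k + 2) * (real t * fact (2 * k))"
      by (simp add: k algebra_simps)
    moreover have "(2 ^ Suc k * fact (Suc k) :: real) = real (2 * k + 2) * (2 ^ k * fact k)"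
      by (simp add: algebra_simps)
    ultimately show ?thesis
      by (simp only: mult_divide_mult_cancel_left_if times_divide_eq_right) simp
  qed
  also have "fact (2 * k) / (2 ^ k * fact k) = normal_moment (t - 1)"
    using integral_std_normal_moment_even[of k] by (simp add: normal_moment_def k)
  finally show ?thesis .
qed

definition monochromatic :: "('b \<Rightarrow> 'c) \<Rightarrow> 'b set set \<Rightarrow> bool"
  where "monochromatic a p \<longleftrightarrow> (\<forall>B\<in>p. \<forall>k\<in>B. \<forall>l\<in>B. a k = a l)"

text \<open>
  Both sides satisfy the same recursion. A point in a colour class of size \<open>t + 1\<close> has \<open>t\<close> possible
  partners, and removing it with any of them leaves a class of size \<open>t - 1\<close>; the moments
  obey \<open>m\<^sub>t\<^sub>+\<^sub>1 = t m\<^sub>t\<^sub>-\<^sub>1\<close>.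
\<close>

lemma sum_monochromatic_pairings:
  fixes a :: "'b \<Rightarrow> 'c"
  assumes I: "finite I" and S: "finite S" and aI: "a ` S \<subseteq> I"
  shows "(\<Sum>p\<in>pairings_of S. of_bool (monochromatic a p))
    = (\<Prod>v\<in>I. normal_moment (card {k \<in> S. a k = v}))"
  using S aI
proof (induction S rule: finite_psubset_induct)
  case (psubset S)
  show ?case
  proof (cases "S = {}")
    case True
    then show ?thesis
      by (simp add: pairings_of_empty monochromatic_def normal_moment_0)
  next
    case False
    then obtain x T where T: "S = insert x T" "x \<notin> T"
      by (meson mk_disjoint_insert all_not_in_conv)
    have finT: "finite T" using psubset.hyps T by simp
    have xI: "a x \<in> I" using psubset.prems T by auto
    define N where "N = {y \<in> T. a y = a x}"
    have finN: "finite N" using finT by (simp add: N_def)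
    let ?R = "\<Prod>v\<in>I - {a x}. normal_moment (card {k \<in> S. a k = v})"
    have step: "(\<Sum>q\<in>pairings_of (T - {y}). of_bool (monochromatic a (insert {x, y} q)))
        = of_bool (y \<in> N) * (normal_moment (card N - 1) * ?R)" if y: "y \<in> T" for y
    proof (cases "a y = a x")
      case True
      have "(\<Sum>q\<in>pairings_of (T - {y}). of_bool (monochromatic a (insert {x, y} q)) :: real)
          = (\<Sum>q\<in>pairings_of (T - {y}). of_bool (monochromatic a q))"
        using True by (intro sum.cong refl arg_cong[where f = of_bool]) (auto simp: monochromatic_def)
      also have "\<dots> = (\<Prod>v\<in>I. normal_moment (card {k \<in> T - {y}. a k = v}))"
        using psubset.prems T y by (intro psubset.IH) auto
      also have "\<dots> = normal_moment (card {k \<in> T - {y}. a k = a x})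
          * (\<Prod>v\<in>I - {a x}. normal_moment (card {k \<in> T - {y}. a k = v}))"
        by (rule prod.remove[OF I xI])
      also have "{k \<in> T - {y}. a k = a x} = N - {y}"
        by (auto simp: N_def)
      also have "card (N - {y}) = card N - 1"
        using y True finN by (simp add: N_def)
      also have "(\<Prod>v\<in>I - {a x}. normal_moment (card {k \<in> T - {y}. a k = v})) = ?R"
        using True T by (intro prod.cong refl arg_cong[where f = "\<lambda>A. normal_moment (card A)"]) auto
      finally show ?thesis
        using y True by (simp add: N_def)
    next
      case False
      then have "\<not> monochromatic a (insert {x, y} q)" for q
        by (auto simp: monochromatic_def)
      then show ?thesis
        using False by (simp add: N_def)
    qed
    have "(\<Sum>p\<in>pairings_of S. of_bool (monochromatic a p))
        = (\<Sum>y\<in>T. of_bool (y \<in> N) * (normal_moment (card N - 1) * ?R))"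
      unfolding T(1) sum_pairings_of_insert[OF finT T(2)] using step T(1) by (intro sum.cong refl) simp
    also have "\<dots> = (\<Sum>y\<in>T. of_bool (y \<in> N)) * (normal_moment (card N - 1) * ?R)"
      by (rule sum_distrib_right[symmetric])
    also have "(\<Sum>y\<in>T. of_bool (y \<in> N) :: real) = real (card N)"
      using finT by (simp add: N_def Int_def)
    also have "real (card N) * (normal_moment (card N - 1) * ?R) = normal_moment (Suc (card N)) * ?R"
      by (simp add: normal_moment_Suc)
    also have "Suc (card N) = card {k \<in> S. a k = a x}"
    proof -
      have "{k \<in> S. a k = a x} = insert x N" "x \<notin> N"
        using T by (auto simp: N_def)
      then show ?thesis using finN by simp
    qed
    also have "normal_moment (card {k \<in> S. a k = a x}) * ?R
        = (\<Prod>v\<in>I. normal_moment (card {k \<in> S. a k = v}))"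
      by (rule prod.remove[OF I xI, symmetric])
    finally show ?thesis .
  qed
qed

text \<open>
  Wick's formula for a family whose covariance is \<open>0\<close> or \<open>1\<close>: by independence the expectation is
  the product of the moments of the individual variables, one for each colour class of \<open>a\<close>.
\<close>

lemma (in prob_space) gaussian_wick:
  fixes g :: "'c \<Rightarrow> 'a \<Rightarrow> real" and a :: "'b \<Rightarrow> 'c"
  assumes I: "finite I" and ind: "indep_vars (\<lambda>_. borel) g I"
    and normal: "\<And>v. v \<in> I \<Longrightarrow> distributed M lborel (g v) std_normal_density"
    and S: "finite S" and aI: "a ` S \<subseteq> I"
  shows "integrable M (\<lambda>\<omega>. \<Prod>k\<in>S. g (a k) \<omega>)"
    and "expectation (\<lambda>\<omega>. \<Prod>k\<in>S. g (a k) \<omega>) = (\<Sum>p\<in>pairings_of S. of_bool (monochromatic a p))"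
proof -
  define c where "c v = card {k \<in> S. a k = v}" for v
  have eq: "(\<Prod>k\<in>S. g (a k) \<omega>) = (\<Prod>v\<in>I. g v \<omega> ^ c v)" for \<omega>
  proof -
    have "(\<Prod>k\<in>S. g (a k) \<omega>) = (\<Prod>v\<in>I. \<Prod>k\<in>{k \<in> S. a k = v}. g (a k) \<omega>)"
      by (rule prod.group[OF S I aI, symmetric])
    also have "\<dots> = (\<Prod>v\<in>I. g v \<omega> ^ c v)"
      by (intro prod.cong refl) (simp add: c_def)
    finally show ?thesis .
  qed
  have indc: "indep_vars (\<lambda>_. borel) (\<lambda>v \<omega>. g v \<omega> ^ c v) I"
    by (rule indep_vars_compose2[OF ind]) simp
  have int: "integrable M (\<lambda>\<omega>. g v \<omega> ^ c v)" if "v \<in> I" for v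
    using distributed_integrable[OF normal[OF that], of "\<lambda>x. x ^ c v"]
      integrable_std_normal_moment[of "c v"] by simp
  have exp: "expectation (\<lambda>\<omega>. g v \<omega> ^ c v) = normal_moment (c v)" if "v \<in> I" for v
    using distributed_integral[OF normal[OF that], of "\<lambda>x. x ^ c v"] by (simp add: normal_moment_def)
  show "integrable M (\<lambda>\<omega>. \<Prod>k\<in>S. g (a k) \<omega>)"
    unfolding eq by (rule indep_vars_integrable[OF I indc int])
  show "expectation (\<lambda>\<omega>. \<Prod>k\<in>S. g (a k) \<omega>) = (\<Sum>p\<in>pairings_of S. of_bool (monochromatic a p))"
    unfolding eq sum_monochromatic_pairings[OF I S aI]
    using indep_vars_lebesgue_integral[OF I indc int] exp by (simp add: c_def)
qed

section \<open>Halving a permutation with reflected cycles\<close>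

text \<open>
  Condition \<open>reflect\<close> says that the inverse of \<open>K\<close> is its conjugate by negation, so negation maps
  a cycle to a cycle traversed backwards; \<open>no_reflection\<close> then prevents a cycle from
  being its own mirror image. This allows selecting one cycle from each mirror pair.
\<close>

locale reflected_perm =
  fixes Q :: "int set" and K :: "int \<Rightarrow> int"
  assumes fin: "finite Q" and zero: "0 \<notin> Q"
    and neg: "c \<in> Q \<Longrightarrow> - c \<in> Q"
    and closed: "c \<in> Q \<Longrightarrow> K c \<in> Q"
    and reflect: "c \<in> Q \<Longrightarrow> K (- K c) = - c"
    and no_reflection: "c \<in> Q \<Longrightarrow> K c \<noteq> - c"
begin

definition half :: "int set"
  where "half = {c \<in> Q. particular (orbit K c)}"

lemma inj: "inj_on K Q"
  by (rule inj_onI) (metis reflect minus_minus)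

abbreviation "\<kappa> \<equiv> perm_restrict K Q"

lemma permutes: "\<kappa> permutes Q"
proof (rule bij_imp_permutes)
  have "bij_betw K Q Q"
    using inj fin closed by (simp add: bij_betw_def endo_inj_surj image_subsetI)
  then show "bij_betw \<kappa> Q Q"
    by (rule bij_betw_cong[THEN iffD1, rotated]) (simp add: perm_restrict_simps)
qed (simp add: perm_restrict_simps)

lemma permutation: "permutation \<kappa>"
  using permutes fin permutation_permutes by blast

lemma orbit_restrict: "c \<in> Q \<Longrightarrow> orbit K c = orbit \<kappa> c"
  by (rule orbit_cong0[of _ Q]) (auto simp: closed perm_restrict_simps)

lemma orbit_subset: "c \<in> Q \<Longrightarrow> orbit K c \<subseteq> Q"
  using permutes_orbit_subset[OF permutes] by (simp add: orbit_restrict)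

lemma self_in_orbit: "c \<in> Q \<Longrightarrow> c \<in> orbit K c"
  by (simp add: orbit_restrict permutation_self_in_orbit[OF permutation])

lemma orbit_K: "c \<in> Q \<Longrightarrow> orbit K (K c) = orbit K c"
  using self_in_orbit by (rule self_in_orbit_step)

lemma orbit_neg:
  assumes c: "c \<in> Q"
  shows "orbit K (- c) = uminus ` orbit K c"
proof -
  have "uminus ` orbit \<kappa> c = orbit (inv_into UNIV \<kappa>) (- c)"
  proof (rule orbit_inverse)
    show "c \<in> orbit \<kappa> c"
      by (rule permutation_self_in_orbit[OF permutation])
    fix x assume "x \<in> orbit \<kappa> c"
    then have "x \<in> Q"
      using permutes_orbit_subset[OF permutes c] by blast
    then have "\<kappa> (- \<kappa> x) = - x"
      by (simp add: perm_restrict_simps closed neg reflect)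
    then show "inv_into UNIV \<kappa> (- x) = - \<kappa> x"
      using permutes_inv_eq[OF permutes] by simp
  qed
  then show ?thesis
    using c neg by (simp add: orbit_restrict orbit_inv_eq[OF permutation])
qed

text \<open>
  If \<open>K\<^sup>m c = - c\<close>, then \<open>K\<^sup>m\<^sup>-\<^sup>2 (K c) = - K c\<close>; descending two steps at a time contradicts
  \<open>K c \<noteq> - c\<close> or \<open>c \<noteq> 0\<close>.
\<close>

lemma funpow_neq_neg: "c \<in> Q \<Longrightarrow> (\<kappa> ^^ m) c \<noteq> - c"
proof (induction m arbitrary: c rule: induct_nat_012)
  case 0
  then show ?case using zero by auto
next
  case 1
  then show ?case using no_reflection by (simp add: perm_restrict_simps)
next
  case (ge2 m)
  show ?case
  proof
    assume "(\<kappa> ^^ Suc (Suc m)) c = - c"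
    then have "\<kappa> ((\<kappa> ^^ m) (\<kappa> c)) = \<kappa> (- K c)"
      using ge2.prems by (simp add: funpow_swap1 perm_restrict_simps closed neg reflect)
    then have "(\<kappa> ^^ m) (\<kappa> c) = - K c"
      using permutes_inj[OF permutes] by (simp add: inj_eq)
    then show False
      using ge2.IH(1)[of "K c"] ge2.prems by (simp add: perm_restrict_simps closed)
  qed
qed

lemma neg_notin_orbit:
  assumes "c \<in> Q"
  shows "- c \<notin> orbit K c"
  unfolding orbit_restrict[OF assms] unfolding orbit_altdef
  using funpow_neq_neg[OF assms, THEN not_sym] by simp

lemma orbit_eq: "c \<in> Q \<Longrightarrow> d \<in> orbit K c \<Longrightarrow> orbit K d = orbit K c"
  using orbit_cyclic_eq3[OF cyclic_on_orbit'[OF permutation]] orbit_subset[of c]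
  by (metis orbit_restrict subsetD)

text \<open>
  Since a cycle never contains both \<open>c\<close> and \<open>- c\<close>, its element of least absolute value is unique,
  and negation flips the sign of that element.
\<close>

lemma particular_neg:
  assumes c: "c \<in> Q"
  shows "particular (orbit K (- c)) \<longleftrightarrow> \<not> particular (orbit K c)"
proof -
  have fin_o: "finite (orbit K c)" and ne: "orbit K c \<noteq> {}"
    using finite_subset[OF orbit_subset[OF c] fin] orbit_nonempty by fast+
  obtain m where m: "m \<in> orbit K c" "\<And>d. d \<in> orbit K c \<Longrightarrow> \<bar>m\<bar> \<le> \<bar>d\<bar>"
    using ex_min_if_finite[of "abs ` orbit K c"] fin_o ne
    by (metis (no_types, lifting) arg_min_if_finite(1) arg_min_least)
  have m0: "m \<noteq> 0"
    using m(1) orbit_subset[OF c] zero by auto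
  have nm: "- m \<notin> orbit K c"
    using neg_notin_orbit[of m] orbit_eq[OF c m(1)] orbit_subset[OF c] m(1) by auto
  have 1: "particular (orbit K c) \<longleftrightarrow> m > 0"
  proof
    assume "particular (orbit K c)"
    then obtain e where e: "e \<in> orbit K c" "e > 0" "\<And>d. d \<in> orbit K c \<Longrightarrow> \<bar>e\<bar> \<le> \<bar>d\<bar>"
      by (auto simp: particular_def)
    have "\<bar>e\<bar> = \<bar>m\<bar>"
      using e(3)[OF m(1)] m(2)[OF e(1)] by simp
    then have "e = m"
      using nm e(1) by (auto simp: abs_if split: if_splits)
    then show "m > 0" using e by simp
  qed (use m in \<open>auto simp: particular_def\<close>)
  have 2: "particular (orbit K (- c)) \<longleftrightarrow> m < 0"
  proof
    assume "particular (orbit K (- c))"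
    then obtain e where e: "e \<in> orbit K c" "- e > 0" "\<And>d. d \<in> orbit K c \<Longrightarrow> \<bar>e\<bar> \<le> \<bar>d\<bar>"
      by (auto simp: particular_def orbit_neg[OF c])
    have "\<bar>e\<bar> = \<bar>m\<bar>"
      using e(3)[OF m(1)] m(2)[OF e(1)] by simp
    then have "e = m"
      using nm e(1) by (auto simp: abs_if split: if_splits)
    then show "m < 0" using e by simp
  qed (use m in \<open>auto simp: particular_def orbit_neg[OF c]\<close>)
  show ?thesis
    using 1 2 m0 by auto
qed

lemma half_subset: "half \<subseteq> Q"
  by (auto simp: half_def)

lemma half_neg: "c \<in> Q \<Longrightarrow> - c \<in> half \<longleftrightarrow> c \<notin> half"
  using particular_neg neg by (auto simp: half_def)

lemma half_closed: "c \<in> half \<Longrightarrow> K c \<in> half"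
  using orbit_K closed by (auto simp: half_def)

lemma half_permutes: "perm_restrict K half permutes half"
proof (rule bij_imp_permutes)
  have "bij_betw K half half"
    using inj_on_subset[OF inj half_subset] finite_subset[OF half_subset fin] half_closed
    by (simp add: bij_betw_def endo_inj_surj image_subsetI)
  then show "bij_betw (perm_restrict K half) half half"
    by (rule bij_betw_cong[THEN iffD1, rotated]) (simp add: perm_restrict_simps)
qed (simp add: perm_restrict_simps)

lemma K_image_half: "K ` half = half"
  using inj_on_subset[OF inj half_subset] finite_subset[OF half_subset fin] half_closed
  by (simp add: endo_inj_surj image_subsetI)

end

section \<open>The permutations of the word structure\<close>

lemma cycle_of_list_step:
  assumes "xs \<noteq> []" "distinct xs"
  shows "successively (\<lambda>x y. cycle_of_list xs x = y) xs" "cycle_of_list xs (last xs) = hd xs"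
proof -
  have "cycle_of_list xs (xs ! i) = xs ! (Suc i mod length xs)" if "i < length xs" for i
    using arg_cong[OF cyclic_rotation[OF assms(2), of 1], of "\<lambda>ys. ys ! i"] that
    by (simp add: nth_rotate1)
  then show "successively (\<lambda>x y. cycle_of_list xs x = y) xs" "cycle_of_list xs (last xs) = hd xs"
    using assms(1) by (auto simp: successively_conv_nth last_conv_nth hd_conv_nth)
qed

lemma cycle_of_list_uminus:
  fixes xs :: "int list"
  assumes "distinct xs"
  shows "cycle_of_list (map uminus xs) x = - cycle_of_list xs (- x)"
proof -
  have "bij (uminus :: int \<Rightarrow> int)" "inv_into UNIV (uminus :: int \<Rightarrow> int) = uminus"
    by (auto intro!: inv_equality simp: bij_uminus)
  then show ?thesis
    using conjugation_of_cycle[OF assms, of uminus] by (metis comp_apply)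
qed

lemma foldr_comp: "foldr (\<circ>) fs g = foldr (\<circ>) fs id \<circ> g"
  by (induction fs) (simp_all add: comp_assoc)

lemma gamma_plus_Suc:
  "gamma_plus ns (Suc r) = gamma_plus ns r \<circ> cycle_of_list (part_list ns (Suc r))"
proof -
  have upt: "[1..<Suc (Suc r)] = [1..<Suc r] @ [Suc r]" by simp
  show ?thesis
    unfolding gamma_plus_def upt
    by (simp add: foldr_comp[of _ "cycle_of_list _"] del: upt_Suc)
qed

lemma gamma_minus_Suc:
  "gamma_minus ns (Suc r)
    = gamma_minus ns r \<circ> cycle_of_list (map uminus (part_list ns (Suc r)))"
proof -
  have upt: "[1..<Suc (Suc r)] = [1..<Suc r] @ [Suc r]" by simp
  show ?thesis
    unfolding gamma_minus_def upt
    by (simp add: foldr_comp[of _ "cycle_of_list _"] del: upt_Suc)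
qed

lemma distinct_part_list: "distinct (part_list ns k)"
  by (simp add: part_list_def)

lemma part_end_mono: "k \<le> l \<Longrightarrow> part_end ns k \<le> part_end ns l"
  by (simp add: part_end_def sum_mono2)

lemma part_end_nonneg: "0 \<le> part_end ns k"
  by (simp add: part_end_def del: of_nat_sum)

lemma set_part_list: "set (part_list ns k) = {part_end ns (k - 1) + 1..part_end ns k}"
  by (simp add: part_list_def)

lemma part_list_disjoint:
  assumes "k < l"
  shows "set (part_list ns k) \<inter> set (part_list ns l) = {}"
proof -
  have "part_end ns k \<le> part_end ns (l - 1)"
    using assms by (intro part_end_mono) simp
  then show ?thesis by (auto simp: set_part_list)
qed

lemma UN_part_list: "(\<Union>k\<in>{1..r}. set (part_list ns k)) = {1..part_end ns r}"
proof (induction r)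
  case 0
  then show ?case by (simp add: part_end_def)
next
  case (Suc r)
  have "{1..Suc r} = insert (Suc r) {1..r}" by auto
  then have "(\<Union>k\<in>{1..Suc r}. set (part_list ns k))
      = {part_end ns r + 1..part_end ns (Suc r)} \<union> {1..part_end ns r}"
    using Suc by (simp add: set_part_list)
  also have "\<dots> = {1..part_end ns (Suc r)}"
    using part_end_mono[of r "Suc r" ns] part_end_nonneg[of ns r] by auto
  finally show ?case .
qed

lemma gamma_plus_permutes: "gamma_plus ns r permutes {1..part_end ns r}"
proof (induction r)
  case 0
  then show ?case by (simp add: gamma_plus_def permutes_id[unfolded id_def])
next
  case (Suc r)
  have "gamma_plus ns r permutes {1..part_end ns (Suc r)}"
    using part_end_mono[of r "Suc r" ns] by (intro permutes_subset[OF Suc]) auto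
  moreover have "cycle_of_list (part_list ns (Suc r)) permutes {1..part_end ns (Suc r)}"
    using part_end_nonneg[of ns r]
    by (intro permutes_subset[OF cycle_permutes]) (auto simp: set_part_list)
  ultimately show ?case
    unfolding gamma_plus_Suc by (intro permutes_compose)
qed

lemma gamma_plus_part:
  assumes "k \<in> {1..r}" "x \<in> set (part_list ns k)"
  shows "gamma_plus ns r x = cycle_of_list (part_list ns k) x"
  using assms
proof (induction r)
  case (Suc r)
  show ?case
  proof (cases "k = Suc r")
    case True
    have "cycle_of_list (part_list ns (Suc r)) x \<in> set (part_list ns (Suc r))"
      using Suc.prems True permutes_in_image[OF cycle_permutes] by metis
    then have "cycle_of_list (part_list ns (Suc r)) x \<notin> {1..part_end ns r}"
      by (auto simp: set_part_list)
    then show ?thesis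
      using permutes_not_in[OF gamma_plus_permutes] True by (simp add: gamma_plus_Suc)
  next
    case False
    then have "x \<notin> set (part_list ns (Suc r))"
      using Suc.prems part_list_disjoint[of k "Suc r" ns] by auto
    then show ?thesis
      using Suc False by (simp add: gamma_plus_Suc id_outside_supp)
  qed
qed simp

lemma gamma_minus_eq: "gamma_minus ns r x = - gamma_plus ns r (- x)"
proof (induction r arbitrary: x)
  case 0
  then show ?case by (simp add: gamma_minus_def gamma_plus_def)
next
  case (Suc r)
  then show ?case
    by (simp add: gamma_minus_Suc gamma_plus_Suc cycle_of_list_uminus distinct_part_list)
qed

lemma inv_gamma_minus:
  "inv_into UNIV (gamma_minus ns r) x = - inv_into UNIV (gamma_plus ns r) (- x)"
proof (rule inv_f_eq)
  note g = gamma_plus_permutes[of ns r]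
  show "inj (gamma_minus ns r)"
    by (rule injI) (simp add: gamma_minus_eq inj_eq[OF permutes_inj[OF g]])
  show "gamma_minus ns r (- inv_into UNIV (gamma_plus ns r) (- x)) = x"
    by (simp add: gamma_minus_eq permutes_inverses[OF g])
qed

lemma kreweras_perm_eq:
  "kreweras_perm ns r \<epsilon> p x
    = - inv_into UNIV (gamma_plus ns r) (- pi_hat \<epsilon> p (gamma_plus ns r x))"
  by (simp add: kreweras_perm_def inv_gamma_minus)

lemma mem_pm_interval: "x \<in> pm_interval n \<longleftrightarrow> \<bar>x\<bar> \<in> {1..int n}"
  by (auto simp: pm_interval_def)

lemma pairing_perm_props:
  assumes p: "p \<in> pairings_of {1..int n}"
  shows "k \<in> {1..int n} \<Longrightarrow> pairing_perm p k \<in> {1..int n}"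
    and "k \<in> {1..int n} \<Longrightarrow> pairing_perm p k \<noteq> k"
    and "k \<in> {1..int n} \<Longrightarrow> {k, pairing_perm p k} \<in> p"
    and "k \<in> {1..int n} \<Longrightarrow> pairing_perm p (pairing_perm p k) = k"
    and "k \<notin> {1..int n} \<Longrightarrow> pairing_perm p k = k"
proof -
  have U: "\<Union>p = {1..int n}"
    using p by (auto simp: pairings_of_def partition_on_def)
  have char: "pairing_perm p k \<in> {1..int n} \<and> pairing_perm p k \<noteq> k \<and> {k, pairing_perm p k} \<in> p
      \<and> (\<forall>z. z \<noteq> k \<longrightarrow> {k, z} \<in> p \<longrightarrow> z = pairing_perm p k)" if k: "k \<in> {1..int n}" for k
  proof -
    obtain y where y: "y \<in> {1..int n}" "y \<noteq> k" "{k, y} \<in> p" "\<And>z. z \<noteq> k \<Longrightarrow> {k, z} \<in> p \<Longrightarrow> z = y"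
      using pairing_partner[OF p k] by blast
    have "(THE l. l \<noteq> k \<and> {k, l} \<in> p) = y"
      by (rule the_equality) (use y in blast)+
    then have "pairing_perm p k = y"
      unfolding pairing_perm_def U using k by simp
    then show ?thesis using y by blast
  qed
  show "k \<in> {1..int n} \<Longrightarrow> pairing_perm p k \<in> {1..int n}"
    "k \<in> {1..int n} \<Longrightarrow> pairing_perm p k \<noteq> k"
    "k \<in> {1..int n} \<Longrightarrow> {k, pairing_perm p k} \<in> p"
    using char by blast+
  show "pairing_perm p (pairing_perm p k) = k" if k: "k \<in> {1..int n}"
    using char[OF k] char[of "pairing_perm p k"] by (metis insert_commute)
  show "pairing_perm p k = k" if "k \<notin> {1..int n}"
    unfolding pairing_perm_def U using that by (simp only: if_False)
qed

text \<open>
  Wick's formula speaks of the blocks of a pairing, the gluing of indices of the permutation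
  swapping them; this translates between the two.
\<close>

lemma monochromatic_iff:
  assumes p: "p \<in> pairings_of {1..int n}"
  shows "monochromatic a p \<longleftrightarrow> (\<forall>k\<in>{1..int n}. a (pairing_perm p k) = a k)"
proof
  assume m: "monochromatic a p"
  show "\<forall>k\<in>{1..int n}. a (pairing_perm p k) = a k"
  proof
    fix k assume "k \<in> {1..int n}"
    from pairing_perm_props(3)[OF p this] show "a (pairing_perm p k) = a k"
      by (rule m[unfolded monochromatic_def, THEN bspec, THEN bspec, THEN bspec]) simp_all
  qed
next
  assume *: "\<forall>k\<in>{1..int n}. a (pairing_perm p k) = a k"
  show "monochromatic a p"
    unfolding monochromatic_def
  proof (intro ballI)
    fix B k l assume B: "B \<in> p" and kl: "k \<in> B" "l \<in> B"
    have k: "k \<in> {1..int n}"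
      using p B kl by (auto simp: pairings_of_def partition_on_def)
    have "card B = 2" using p B by (auto simp: pairings_of_def)
    moreover have "{k, pairing_perm p k} \<in> p" by (rule pairing_perm_props(3)[OF p k])
    then have "B = {k, pairing_perm p k}"
      using disjointD[of p B "{k, pairing_perm p k}"] p B kl(1)
      by (auto simp: pairings_of_def partition_on_def)
    ultimately show "a k = a l"
      using * k kl(2) by auto
  qed
qed

lemma delta'_props:
  assumes \<epsilon>: "\<forall>k\<in>{1..int n}. \<epsilon> k \<in> {-1, 1}" and x: "\<bar>x\<bar> \<in> {1..int n}"
  shows "\<bar>delta' \<epsilon> x\<bar> = \<bar>x\<bar>" "delta' \<epsilon> (delta' \<epsilon> x) = x" "delta' \<epsilon> (- x) = - delta' \<epsilon> x"
  using bspec[OF \<epsilon> x] x by (auto simp: delta'_def)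

text \<open>
  For the coordinate \<open>\<delta>' k\<close> of a row index of \<open>X\<close> and \<open>- \<delta>' k\<close> of the corresponding column index,
  \<open>x \<mapsto> pi_hat \<epsilon> p (- x)\<close> moves row indices to row indices and column indices to column indices, both
  along \<open>p\<close>. All properties of \<open>pi_hat\<close> follow from this description.
\<close>

lemma pi_hat_delta':
  assumes \<epsilon>: "\<forall>k\<in>{1..int n}. \<epsilon> k \<in> {-1, 1}" and p: "p \<in> pairings_of {1..int n}"
    and k: "k \<in> {1..int n}"
  shows "pi_hat \<epsilon> p (delta' \<epsilon> k) = - delta' \<epsilon> (pairing_perm p k)"
    and "pi_hat \<epsilon> p (- delta' \<epsilon> k) = delta' \<epsilon> (pairing_perm p k)"
proof -
  have k': "\<bar>k\<bar> \<in> {1..int n}" "\<bar>- k\<bar> \<in> {1..int n}"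
    using k by auto
  note d = delta'_props[OF \<epsilon> k'(1)] delta'_props[OF \<epsilon> k'(2)]
  have s: "pairing_perm p k \<in> {1..int n}"
    by (rule pairing_perm_props(1)[OF p k])
  have fixed: "pairing_perm p (- l) = - l" if "l \<in> {1..int n}" for l
    using that by (intro pairing_perm_props(5)[OF p]) auto
  have "delta' \<epsilon> (- pairing_perm p k) = - delta' \<epsilon> (pairing_perm p k)"
    using s by (intro delta'_props(3)[OF \<epsilon>]) auto
  then show "pi_hat \<epsilon> p (delta' \<epsilon> k) = - delta' \<epsilon> (pairing_perm p k)"
    using d(2) fixed[OF s] by (simp add: pi_hat_def delta_def)
  have "- delta' \<epsilon> k = delta' \<epsilon> (- k)" "delta' \<epsilon> (delta' \<epsilon> (- k)) = - k"
    using d by simp_all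
  then show "pi_hat \<epsilon> p (- delta' \<epsilon> k) = delta' \<epsilon> (pairing_perm p k)"
    using fixed[OF k] by (simp add: pi_hat_def delta_def)
qed

lemma delta'_cases:
  assumes \<epsilon>: "\<forall>k\<in>{1..int n}. \<epsilon> k \<in> {-1, 1}" and x: "x \<in> pm_interval n"
  obtains k where "k \<in> {1..int n}" "x = delta' \<epsilon> k" | k where "k \<in> {1..int n}" "x = - delta' \<epsilon> k"
proof -
  have x': "\<bar>x\<bar> \<in> {1..int n}" using x by (simp add: mem_pm_interval)
  have "x = delta' \<epsilon> \<bar>x\<bar> \<or> x = - delta' \<epsilon> \<bar>x\<bar>"
    using bspec[OF \<epsilon> x'] by (auto simp: delta'_def)
  then show thesis using that x' by blast
qed

lemma pi_hat_props:
  assumes \<epsilon>: "\<forall>k\<in>{1..int n}. \<epsilon> k \<in> {-1, 1}" and p: "p \<in> pairings_of {1..int n}"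
    and x: "x \<in> pm_interval n"
  shows "pi_hat \<epsilon> p x \<in> pm_interval n" "pi_hat \<epsilon> p (pi_hat \<epsilon> p x) = x"
    "pi_hat \<epsilon> p (- x) = - pi_hat \<epsilon> p x" "pi_hat \<epsilon> p x \<noteq> - x"
    "delta' \<epsilon> (pi_hat \<epsilon> p x) > 0 \<longleftrightarrow> delta' \<epsilon> x < 0"
proof -
  let ?P = "\<lambda>x. pi_hat \<epsilon> p x \<in> pm_interval n \<and> pi_hat \<epsilon> p (pi_hat \<epsilon> p x) = x
    \<and> pi_hat \<epsilon> p (- x) = - pi_hat \<epsilon> p x \<and> pi_hat \<epsilon> p x \<noteq> - x
    \<and> (delta' \<epsilon> (pi_hat \<epsilon> p x) > 0 \<longleftrightarrow> delta' \<epsilon> x < 0)"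
  have main: "?P (delta' \<epsilon> k)" "?P (- delta' \<epsilon> k)" if k: "k \<in> {1..int n}" for k
  proof -
    define s where "s = pairing_perm p k"
    have s: "s \<in> {1..int n}" "s \<noteq> k" "pairing_perm p s = k"
      using pairing_perm_props[OF p] k by (simp_all add: s_def)
    have k': "\<bar>k\<bar> \<in> {1..int n}" "\<bar>s\<bar> \<in> {1..int n}"
      using k s by auto
    note dk = delta'_props[OF \<epsilon> k'(1)] and ds = delta'_props[OF \<epsilon> k'(2)]
    have a: "\<bar>delta' \<epsilon> k\<bar> \<in> {1..int n}" "\<bar>delta' \<epsilon> s\<bar> \<in> {1..int n}"
      using dk(1) ds(1) k' by simp_all
    have nd: "delta' \<epsilon> (- delta' \<epsilon> k) = - k" "delta' \<epsilon> (- delta' \<epsilon> s) = - s"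
      using delta'_props(3)[OF \<epsilon> a(1)] delta'_props(3)[OF \<epsilon> a(2)] dk(2) ds(2) by simp_all
    have ne: "delta' \<epsilon> s \<noteq> delta' \<epsilon> k"
      using arg_cong[of "delta' \<epsilon> s" "delta' \<epsilon> k" "delta' \<epsilon>"] dk(2) ds(2) s(2) by auto
    have pos: "k > 0" "s > 0"
      using k s by simp_all
    note h = pi_hat_delta'[OF \<epsilon> p k, folded s_def] pi_hat_delta'[OF \<epsilon> p s(1), unfolded s(3)]
    show "?P (delta' \<epsilon> k)"
      using a(2) ne pos by (simp only: h nd dk(2) ds(2) mem_pm_interval) simp
    show "?P (- delta' \<epsilon> k)"
      using a(2) ne pos by (simp only: h nd dk(2) ds(2) mem_pm_interval minus_minus) simp
  qed
  have "?P x"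
    by (rule delta'_cases[OF \<epsilon> x]) (use main in blast)+
  then show "pi_hat \<epsilon> p x \<in> pm_interval n" "pi_hat \<epsilon> p (pi_hat \<epsilon> p x) = x"
    "pi_hat \<epsilon> p (- x) = - pi_hat \<epsilon> p x" "pi_hat \<epsilon> p x \<noteq> - x"
    "delta' \<epsilon> (pi_hat \<epsilon> p x) > 0 \<longleftrightarrow> delta' \<epsilon> x < 0"
    by blast+
qed

section \<open>Traces along the halved permutation\<close>

text \<open>
  Here \<open>\<gamma>\<close> stands for \<open>\<gamma>\<^sub>+\<close> and \<open>h\<close> for \<open>pi_hat\<close>; then \<open>K\<close> is \<open>\<gamma>\<^sub>-\<^sup>-\<^sup>1 h \<gamma>\<^sub>+\<close>, because \<open>\<gamma>\<^sub>-\<close> is the conjugate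
  of \<open>\<gamma>\<^sub>+\<close> by negation. The condition \<open>h x \<noteq> - x\<close> reflects that a pairing has no fixed points.
\<close>

locale glued_word =
  fixes n :: nat and \<gamma> h :: "int \<Rightarrow> int"
  assumes \<gamma>: "\<gamma> permutes {1..int n}"
    and h_closed: "x \<in> pm_interval n \<Longrightarrow> h x \<in> pm_interval n"
    and h_h: "x \<in> pm_interval n \<Longrightarrow> h (h x) = x"
    and h_neg: "x \<in> pm_interval n \<Longrightarrow> h (- x) = - h x"
    and h_neq_neg: "x \<in> pm_interval n \<Longrightarrow> h x \<noteq> - x"
begin

definition K :: "int \<Rightarrow> int"
  where "K x = - inv_into UNIV \<gamma> (- h (\<gamma> x))"

lemma uminus_pm: "- x \<in> pm_interval n \<longleftrightarrow> x \<in> pm_interval n"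
  by (simp add: mem_pm_interval)

lemma \<gamma>_pm: "\<gamma> permutes pm_interval n"
  by (rule permutes_subset[OF \<gamma>]) (auto simp: pm_interval_def)

lemma \<gamma>_in: "\<gamma> x \<in> pm_interval n \<longleftrightarrow> x \<in> pm_interval n"
  by (rule permutes_in_image[OF \<gamma>_pm])

lemma K_in: "x \<in> pm_interval n \<Longrightarrow> K x \<in> pm_interval n"
  using permutes_in_image[OF permutes_inv[OF \<gamma>_pm]] by (simp add: K_def uminus_pm h_closed \<gamma>_in)

lemma \<gamma>_neg_K: "\<gamma> (- K x) = - h (\<gamma> x)"
  by (simp add: K_def permutes_inverses[OF \<gamma>])

sublocale reflected_perm "pm_interval n" K
proof
  show "finite (pm_interval n)" "0 \<notin> pm_interval n"
    by (auto simp: pm_interval_def)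
  fix c assume c: "c \<in> pm_interval n"
  show "- c \<in> pm_interval n" "K c \<in> pm_interval n"
    using c by (simp_all add: uminus_pm K_in)
  show "K (- K c) = - c"
    using c unfolding K_def[of "- K c"] \<gamma>_neg_K
    by (simp add: h_neg h_h h_closed \<gamma>_in permutes_inverses[OF \<gamma>])
  show "K c \<noteq> - c"
  proof
    assume "K c = - c"
    then have "h (\<gamma> c) = - \<gamma> c"
      using \<gamma>_neg_K[of c] by simp
    then show False
      using h_neq_neg[of "\<gamma> c"] c by (simp add: \<gamma>_in)
  qed
qed

lemma half_dom_eq: "half_dom n K = half"
  by (simp add: half_dom_def half_def)

lemma abs_half: "bij_betw abs half {1..int n}"
  unfolding bij_betw_def
proof
  show "inj_on abs half"
    using half_neg half_subset by (intro inj_onI) (auto simp: abs_if split: if_splits)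
  show "abs ` half = {1..int n}"
  proof
    show "abs ` half \<subseteq> {1..int n}"
      using half_subset mem_pm_interval by blast
    show "{1..int n} \<subseteq> abs ` half"
    proof
      fix k assume k: "k \<in> {1..int n}"
      then have "k \<in> half \<or> - k \<in> half"
        using half_neg[of k] by (auto simp: mem_pm_interval)
      then show "k \<in> abs ` half"
        using k by (auto intro: image_eqI[of _ _ k] image_eqI[of _ _ "- k"])
    qed
  qed
qed

text \<open>
  The row index of the \<open>c\<close>-th factor \<open>D\<^sup>(\<^sup>\<plusminus>\<^sup>1\<^sup>)\<close> sits at position \<open>\<theta> c = \<gamma> (- c)\<close> and its column index at
  position \<open>\<gamma> c\<close>; \<open>\<rho> x = h (- x)\<close> glues \<open>\<gamma> c\<close> to \<open>\<theta> (K c)\<close>. Hence for a \<open>\<rho>\<close>-invariant assignment the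
  column index of one factor is the row index of the next one along \<open>K\<close>. As \<open>c\<close> runs over the
  chosen half, the positions \<open>\<theta> c\<close> form a transversal of the orbits of \<open>\<rho>\<close>, so the invariant
  assignments are exactly the index assignments on that half.
\<close>

lemma trace_half:
  fixes d :: "int \<Rightarrow> nat" and D :: "int \<Rightarrow> real Matrix.mat"
  assumes d: "\<And>x. x \<in> pm_interval n \<Longrightarrow> d (h (- x)) = d x"
    and D: "\<And>k. k \<in> {1..int n} \<Longrightarrow> D k \<in> carrier_mat (d (- k)) (d (\<gamma> k))"
  shows "trace_perm (half_dom n K) (half_perm n K) D
    = (\<Sum>i | i \<in> PiE (pm_interval n) (\<lambda>x. {..<d x}) \<and> (\<forall>x\<in>pm_interval n. i (h (- x)) = i x).
        \<Prod>k\<in>{1..int n}. D k $$ (i (- k), i (\<gamma> k)))"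
proof -
  define \<theta> where "\<theta> c = \<gamma> (- c)" for c
  define \<rho> where "\<rho> x = h (- x)" for x
  let ?D = "\<lambda>c. signed_mat (D \<bar>c\<bar>) (sgn c)"
  have pm: "c \<in> pm_interval n" if "c \<in> half" for c
    using that half_subset by blast
  have \<theta>_in: "\<theta> c \<in> pm_interval n" if "c \<in> half" for c
    using pm[OF that] by (simp add: \<theta>_def \<gamma>_in uminus_pm)
  have \<rho>\<theta>K: "\<rho> (\<theta> (K c)) = \<gamma> c" if "c \<in> half" for c
    using pm[OF that] by (simp add: \<theta>_def \<rho>_def \<gamma>_neg_K h_neg h_h h_closed \<gamma>_in)
  have d\<rho>: "d (\<rho> x) = d x" if "x \<in> pm_interval n" for x
    using d[OF that] by (simp add: \<rho>_def)
  have d\<theta>K: "d (\<theta> (K c)) = d (\<gamma> c)" if "c \<in> half" for c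
    using d\<rho>[OF \<theta>_in[OF half_closed[OF that]]] \<rho>\<theta>K[OF that] by simp
  have \<gamma>neg: "\<gamma> c = c" if "c < 0" for c
    using that by (intro permutes_not_in[OF \<gamma>]) auto
  \<comment> \<open>For \<open>c < 0\<close> the factor is transposed, which swaps the roles of \<open>\<theta> c\<close> and \<open>\<gamma> c\<close>.\<close>
  have signs: "c > 0 \<and> \<bar>c\<bar> = c \<and> sgn c = 1 \<and> \<theta> c = - c
      \<or> c < 0 \<and> \<bar>c\<bar> = - c \<and> sgn c = -1 \<and> \<theta> c = \<gamma> (- c) \<and> \<gamma> c = c" if "c \<in> half" for c
    using pm[OF that] \<gamma>neg[of c] \<gamma>neg[of "- c"]
    by (cases "c > 0"; cases "c = 0") (auto simp: \<theta>_def mem_pm_interval)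
  have car: "?D c \<in> carrier_mat (d (\<theta> c)) (d (\<theta> (K c)))" if c: "c \<in> half" for c
  proof -
    have "D \<bar>c\<bar> \<in> carrier_mat (d (- \<bar>c\<bar>)) (d (\<gamma> \<bar>c\<bar>))"
      using D pm[OF c] by (simp add: mem_pm_interval)
    then show ?thesis
      using signs[OF c] unfolding d\<theta>K[OF c] by (auto simp: signed_mat_def)
  qed
  have \<theta>_inj: "inj_on \<theta> half"
    using permutes_inj[OF \<gamma>] by (intro inj_onI) (simp add: \<theta>_def inj_eq)
  have glue: "\<rho> ` \<theta> ` half = \<gamma> ` half"
  proof -
    have "\<rho> ` \<theta> ` half = (\<lambda>c. \<rho> (\<theta> (K c))) ` half"
      by (subst K_image_half[symmetric]) (simp add: image_image)
    also have "\<dots> = \<gamma> ` half"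
      by (rule image_cong) (simp_all add: \<rho>\<theta>K)
    finally show ?thesis .
  qed
  have \<theta>_image: "\<theta> ` half = \<gamma> ` uminus ` half"
    by (simp add: \<theta>_def image_image)
  have Qhalf: "pm_interval n = uminus ` half \<union> half" and disj: "uminus ` half \<inter> half = {}"
  proof -
    show "pm_interval n = uminus ` half \<union> half"
    proof (intro equalityI subsetI)
      fix x assume "x \<in> pm_interval n"
      then show "x \<in> uminus ` half \<union> half"
        using half_neg[of x] by (auto intro: image_eqI[of _ _ "- x"])
    qed (use pm uminus_pm in auto)
    show "uminus ` half \<inter> half = {}"
      using half_neg pm by auto
  qed
  have Q: "pm_interval n = \<theta> ` half \<union> \<rho> ` \<theta> ` half"
    unfolding glue unfolding \<theta>_image image_Un[symmetric] Qhalf[symmetric]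
    by (rule permutes_image[OF \<gamma>_pm, symmetric])
  have disj': "\<theta> ` half \<inter> \<rho> ` \<theta> ` half = {}"
    unfolding glue unfolding \<theta>_image image_Int[OF permutes_inj[OF \<gamma>], symmetric] disj by simp
  have "trace_perm (half_dom n K) (half_perm n K) D = trace_perm half (perm_restrict K half) D"
    by (simp add: half_dom_eq half_perm_def)
  also have "\<dots> = (\<Sum>j\<in>PiE half (\<lambda>c. {..<d (\<theta> c)}). \<Prod>c\<in>half. ?D c $$ (j c, j (perm_restrict K half c)))"
    using car finite_subset[OF half_subset fin]
    by (intro trace_perm_eq_sum half_permutes) (simp_all add: perm_restrict_simps)
  also have "\<dots> = (\<Sum>j\<in>PiE half (\<lambda>c. {..<d (\<theta> c)}). \<Prod>c\<in>half. ?D c $$ (j c, j (K c)))"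
    by (intro sum.cong prod.cong refl) (simp add: perm_restrict_simps)
  also have "\<dots> = (\<Sum>i | i \<in> PiE (pm_interval n) (\<lambda>x. {..<d x}) \<and> (\<forall>x\<in>pm_interval n. i (\<rho> x) = i x).
      \<Prod>c\<in>half. ?D c $$ ((\<lambda>c\<in>half. i (\<theta> c)) c, (\<lambda>c\<in>half. i (\<theta> c)) (K c)))"
  proof (rule sum_invariant_assignments[OF \<theta>_inj Q disj', symmetric])
    fix x assume x: "x \<in> pm_interval n"
    show "\<rho> (\<rho> x) = x"
      using x by (simp add: \<rho>_def h_neg h_h h_closed uminus_pm)
    show "{..<d (\<rho> x)} = {..<d x}"
      by (simp add: d\<rho>[OF x])
  qed
  also have "\<dots> = (\<Sum>i | i \<in> PiE (pm_interval n) (\<lambda>x. {..<d x}) \<and> (\<forall>x\<in>pm_interval n. i (\<rho> x) = i x).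
      \<Prod>k\<in>{1..int n}. D k $$ (i (- k), i (\<gamma> k)))"
  proof (rule sum.cong[OF refl])
    fix i assume "i \<in> {i \<in> PiE (pm_interval n) (\<lambda>x. {..<d x}). \<forall>x\<in>pm_interval n. i (\<rho> x) = i x}"
    then have i: "\<And>x. x \<in> pm_interval n \<Longrightarrow> i x < d x" "\<And>x. x \<in> pm_interval n \<Longrightarrow> i (\<rho> x) = i x"
      by auto
    have "?D c $$ ((\<lambda>c\<in>half. i (\<theta> c)) c, (\<lambda>c\<in>half. i (\<theta> c)) (K c))
        = D \<bar>c\<bar> $$ (i (- \<bar>c\<bar>), i (\<gamma> \<bar>c\<bar>))" if c: "c \<in> half" for c
    proof -
      have "i (\<theta> (K c)) = i (\<gamma> c)"
        using i(2)[OF \<theta>_in[OF half_closed[OF c]]] \<rho>\<theta>K[OF c] by simp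
      moreover have "D \<bar>c\<bar> \<in> carrier_mat (d (- \<bar>c\<bar>)) (d (\<gamma> \<bar>c\<bar>))"
        using D pm[OF c] by (simp add: mem_pm_interval)
      moreover have "i (- \<bar>c\<bar>) < d (- \<bar>c\<bar>)" "i (\<gamma> \<bar>c\<bar>) < d (\<gamma> \<bar>c\<bar>)"
        using pm[OF c] by (auto intro!: i(1) simp: \<gamma>_in mem_pm_interval[of "\<bar>c\<bar>"] mem_pm_interval[of "- \<bar>c\<bar>"] mem_pm_interval[of c])
      ultimately show ?thesis
        using signs[OF c] c half_closed[OF c] by (auto simp: signed_mat_def)
    qed
    then have "(\<Prod>c\<in>half. ?D c $$ ((\<lambda>c\<in>half. i (\<theta> c)) c, (\<lambda>c\<in>half. i (\<theta> c)) (K c)))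
        = (\<Prod>c\<in>half. D \<bar>c\<bar> $$ (i (- \<bar>c\<bar>), i (\<gamma> \<bar>c\<bar>)))"
      by (rule prod.cong[OF refl])
    also have "\<dots> = (\<Prod>k\<in>{1..int n}. D k $$ (i (- k), i (\<gamma> k)))"
      by (rule prod.reindex_bij_betw[OF abs_half])
    finally show "(\<Prod>c\<in>half. ?D c $$ ((\<lambda>c\<in>half. i (\<theta> c)) c, (\<lambda>c\<in>half. i (\<theta> c)) (K c)))
        = (\<Prod>k\<in>{1..int n}. D k $$ (i (- k), i (\<gamma> k)))" .
  qed
  finally show ?thesis
    unfolding \<rho>_def .
qed

end

section \<open>Expansion of the word traces\<close>

text \<open>
  The factors of a word alternate between \<open>X\<^sup>(\<^sup>\<plusminus>\<^sup>1\<^sup>)\<close> and \<open>D\<close>; the factor \<open>D\<^sub>k\<close> is given the label \<open>- k\<close>.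
\<close>

definition doubled :: "int list \<Rightarrow> int list"
  where "doubled xs = concat (map (\<lambda>j. [j, - j]) xs)"

definition doubled_step :: "(int \<Rightarrow> int) \<Rightarrow> int \<Rightarrow> int"
  where "doubled_step \<gamma> c = (if c > 0 then - c else \<gamma> (- c))"

lemma set_doubled: "set (doubled xs) = set xs \<union> uminus ` set xs"
  by (induction xs) (auto simp: doubled_def)

lemma doubled_cycle:
  assumes "xs \<noteq> []" "distinct xs" "\<And>x. x \<in> set xs \<Longrightarrow> x > 0"
    and "successively (\<lambda>x y. \<gamma> x = y) xs"
  shows "doubled xs \<noteq> []" "distinct (doubled xs)"
    "successively (\<lambda>x y. doubled_step \<gamma> x = y) (doubled xs)"
    "last (doubled xs) = - last xs" "hd (doubled xs) = hd xs"
proof -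
  have "doubled xs \<noteq> [] \<and> distinct (doubled xs)
    \<and> successively (\<lambda>x y. doubled_step \<gamma> x = y) (doubled xs)
    \<and> last (doubled xs) = - last xs \<and> hd (doubled xs) = hd xs"
    using assms
  proof (induction xs rule: induct_list012)
    case (2 x)
    then show ?case by (simp add: doubled_def doubled_step_def)
  next
    case (3 x y zs)
    have pos: "x > 0" "y > 0" "\<And>z. z \<in> set zs \<Longrightarrow> z > 0"
      using "3.prems"(3) by auto
    have IH: "doubled (y # zs) \<noteq> []" "distinct (doubled (y # zs))"
      "successively (\<lambda>x y. doubled_step \<gamma> x = y) (doubled (y # zs))"
      "last (doubled (y # zs)) = - last (y # zs)" "hd (doubled (y # zs)) = y"
      using "3.IH"(2) "3.prems" by auto
    have un: "doubled (x # y # zs) = x # - x # doubled (y # zs)"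
      by (simp add: doubled_def)
    have "x \<notin> set (doubled (y # zs))" "- x \<notin> set (doubled (y # zs))"
      using "3.prems"(2) pos by (force simp: set_doubled)+
    moreover have "doubled_step \<gamma> x = - x" "doubled_step \<gamma> (- x) = y"
      using pos "3.prems"(4) by (auto simp: doubled_step_def)
    ultimately show ?case
      using IH pos by (simp add: un successively_Cons)
  qed simp
  then show "doubled xs \<noteq> []" "distinct (doubled xs)"
    "successively (\<lambda>x y. doubled_step \<gamma> x = y) (doubled xs)"
    "last (doubled xs) = - last xs" "hd (doubled xs) = hd xs"
    by blast+
qed

text \<open>
  The index \<open>i k\<close> is the left index of the \<open>k\<close>-th copy of \<open>X\<close> and \<open>i (- k)\<close> its right index. Giving
  the factors \<open>X\<close> and \<open>D\<close> separate labels makes each word a single cycle of length \<open>2 n\<^sub>k\<close>, so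
  that the cycle expansion of traces applies to all words at once.
\<close>

lemma word_traces_expand:
  fixes D :: "int \<Rightarrow> real Matrix.mat" and X :: "real Matrix.mat" and d :: "int \<Rightarrow> nat"
  assumes ns: "\<And>k. k \<in> {1..r} \<Longrightarrow> ns k > 0"
    and n: "int n = part_end ns r"
    and X: "\<And>k. k \<in> {1..int n} \<Longrightarrow> signed_mat X (\<epsilon> k) \<in> carrier_mat (d k) (d (- k))"
    and D: "\<And>k. k \<in> {1..int n} \<Longrightarrow> D k \<in> carrier_mat (d (- k)) (d (gamma_plus ns r k))"
  shows "(\<Prod>k=1..r. mat_trace (mat_prod (concat (map (\<lambda>j. [signed_mat X (\<epsilon> j), D j]) (part_list ns k)))))
    = (\<Sum>i\<in>PiE (pm_interval n) (\<lambda>x. {..<d x}).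
        (\<Prod>k\<in>{1..int n}. signed_mat X (\<epsilon> k) $$ (i k, i (- k)))
        * (\<Prod>k\<in>{1..int n}. D k $$ (i (- k), i (gamma_plus ns r k))))"
proof -
  let ?\<gamma> = "gamma_plus ns r" and ?L = "\<lambda>k. doubled (part_list ns k)"
  let ?\<sigma> = "doubled_step ?\<gamma>"
  define A where "A c = (if c > 0 then signed_mat X (\<epsilon> c) else D (- c))" for c
  have pos: "x > 0" if "x \<in> set (part_list ns k)" for x k
    using that part_end_nonneg[of ns "k - 1"] by (auto simp: set_part_list)
  have U: "(\<Union>k\<in>{1..r}. set (part_list ns k)) = {1..int n}"
    using UN_part_list n by simp
  have in_n: "x \<in> {1..int n}" if "k \<in> {1..r}" "x \<in> set (part_list ns k)" for k x
    using that U by blast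
  have ne: "part_list ns k \<noteq> []" if k: "k \<in> {1..r}" for k
  proof -
    obtain l where l: "k = Suc l" using k by (cases k) auto
    have "part_end ns k = part_end ns (k - 1) + int (ns k)"
      by (simp add: part_end_def l)
    then show ?thesis using ns[OF k] by (simp add: part_list_def)
  qed
  have map_A: "map A (?L k) = concat (map (\<lambda>j. [signed_mat X (\<epsilon> j), D j]) (part_list ns k))" for k
  proof -
    have "map A (doubled xs) = concat (map (\<lambda>j. [signed_mat X (\<epsilon> j), D j]) xs)"
      if "\<forall>x\<in>set xs. x > 0" for xs
      using that by (induction xs) (auto simp: doubled_def A_def)
    then show ?thesis using pos by blast
  qed
  have \<gamma>_part: "?\<gamma> x \<in> set (part_list ns k)" if "k \<in> {1..r}" "x \<in> set (part_list ns k)" for k x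
    using gamma_plus_part[OF that] that permutes_in_image[OF cycle_permutes] by metis
  have cyc: "?L k \<noteq> []" "distinct (?L k)" "successively (\<lambda>x y. ?\<sigma> x = y) (?L k)"
    "?\<sigma> (last (?L k)) = hd (?L k)" if k: "k \<in> {1..r}" for k
  proof -
    note c = cycle_of_list_step[OF ne[OF k] distinct_part_list]
    have "successively (\<lambda>x y. ?\<gamma> x = y) (part_list ns k)"
      by (rule successively_mono[OF c(1)]) (simp add: gamma_plus_part[OF k])
    note dc = doubled_cycle[OF ne[OF k] distinct_part_list pos[of _ k] this]
    show "?L k \<noteq> []" "distinct (?L k)" "successively (\<lambda>x y. ?\<sigma> x = y) (?L k)"
      using dc by blast+
    have "last (part_list ns k) \<in> set (part_list ns k)"
      using ne[OF k] by simp
    then have "?\<sigma> (- last (part_list ns k)) = hd (part_list ns k)"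
      using pos[of "last (part_list ns k)" k] c(2) gamma_plus_part[OF k]
      by (auto simp: doubled_step_def)
    then show "?\<sigma> (last (?L k)) = hd (?L k)"
      using dc(4,5) by simp
  qed
  have neg_part: "- x \<notin> set (part_list ns l)" if "x \<in> set (part_list ns k)" for x k l
    using pos[OF that] pos[of "- x" l] by auto
  have "(\<Prod>k=1..r. mat_trace (mat_prod (concat (map (\<lambda>j. [signed_mat X (\<epsilon> j), D j]) (part_list ns k)))))
    = (\<Prod>k\<in>{1..r}. \<Sum>i\<in>PiE (set (?L k)) (\<lambda>x. {..<d x}). \<Prod>c\<in>set (?L k). A c $$ (i c, i (?\<sigma> c)))"
  proof (intro prod.cong refl)
    fix k assume k: "k \<in> {1..r}"
    show "mat_trace (mat_prod (concat (map (\<lambda>j. [signed_mat X (\<epsilon> j), D j]) (part_list ns k))))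
      = (\<Sum>i\<in>PiE (set (?L k)) (\<lambda>x. {..<d x}). \<Prod>c\<in>set (?L k). A c $$ (i c, i (?\<sigma> c)))"
      unfolding map_A[symmetric]
    proof (rule trace_mat_prod_cycle[OF cyc[OF k]])
      fix c assume "c \<in> set (?L k)"
      then consider "c \<in> set (part_list ns k)" | x where "c = - x" "x \<in> set (part_list ns k)"
        by (auto simp: set_doubled)
      then show "A c \<in> carrier_mat (d c) (d (?\<sigma> c))"
      proof cases
        case 1
        then show ?thesis
          using pos[OF 1] X[OF in_n[OF k 1]] by (simp add: A_def doubled_step_def)
      next
        case 2
        then show ?thesis
          using pos[OF 2(2)] D[OF in_n[OF k 2(2)]] by (simp add: A_def doubled_step_def)
      qed
    qed
  qed
  also have "\<dots> = (\<Sum>i\<in>PiE (\<Union>k\<in>{1..r}. set (?L k)) (\<lambda>x. {..<d x}).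
      \<Prod>c\<in>(\<Union>k\<in>{1..r}. set (?L k)). A c $$ (i c, i (?\<sigma> c)))"
  proof (rule sum_PiE_blocks)
    fix k l assume kl: "k \<in> {1..r}" "l \<in> {1..r}" "k \<noteq> l"
    have "set (part_list ns k) \<inter> set (part_list ns l) = {}"
      using part_list_disjoint[of k l ns] part_list_disjoint[of l k ns] kl(3)
      by (cases "k < l") auto
    then show "set (?L k) \<inter> set (?L l) = {}"
      using neg_part by (fastforce simp: set_doubled)
  next
    fix k c assume k: "k \<in> {1..r}" and "c \<in> set (?L k)"
    then consider "c \<in> set (part_list ns k)" | x where "c = - x" "x \<in> set (part_list ns k)"
      by (auto simp: set_doubled)
    then show "?\<sigma> c \<in> set (?L k)"
    proof cases
      case 1
      then show ?thesis using pos[OF 1] by (simp add: doubled_step_def set_doubled)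
    next
      case 2
      then show ?thesis
        using pos[OF 2(2)] \<gamma>_part[OF k 2(2)] by (simp add: doubled_step_def set_doubled)
    qed
  qed simp_all
  also have "(\<Union>k\<in>{1..r}. set (?L k)) = {1..int n} \<union> uminus ` {1..int n}"
    unfolding set_doubled UN_Un_distrib U[symmetric] by (simp add: image_UN)
  also have "\<dots> = pm_interval n"
    by (auto simp: pm_interval_def intro: image_eqI[of _ _ "- x" for x])
  also have "(\<Sum>i\<in>PiE (pm_interval n) (\<lambda>x. {..<d x}). \<Prod>c\<in>pm_interval n. A c $$ (i c, i (?\<sigma> c)))
    = (\<Sum>i\<in>PiE (pm_interval n) (\<lambda>x. {..<d x}).
        (\<Prod>k\<in>{1..int n}. signed_mat X (\<epsilon> k) $$ (i k, i (- k)))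
        * (\<Prod>k\<in>{1..int n}. D k $$ (i (- k), i (?\<gamma> k))))"
  proof (intro sum.cong refl)
    fix i
    have "(\<Prod>c\<in>pm_interval n. A c $$ (i c, i (?\<sigma> c)))
      = (\<Prod>c\<in>{1..int n}. A c $$ (i c, i (?\<sigma> c))) * (\<Prod>c\<in>{- int n..-1}. A c $$ (i c, i (?\<sigma> c)))"
      unfolding pm_interval_def by (intro prod.union_disjoint) auto
    also have "(\<Prod>c\<in>{- int n..-1}. A c $$ (i c, i (?\<sigma> c)))
      = (\<Prod>k\<in>{1..int n}. D k $$ (i (- k), i (?\<gamma> k)))"
      by (rule prod.reindex_bij_witness[of _ uminus uminus]) (auto simp: A_def doubled_step_def)
    also have "(\<Prod>c\<in>{1..int n}. A c $$ (i c, i (?\<sigma> c)))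
      = (\<Prod>k\<in>{1..int n}. signed_mat X (\<epsilon> k) $$ (i k, i (- k)))"
      by (intro prod.cong refl) (auto simp: A_def doubled_step_def)
    finally show "(\<Prod>c\<in>pm_interval n. A c $$ (i c, i (?\<sigma> c)))
      = (\<Prod>k\<in>{1..int n}. signed_mat X (\<epsilon> k) $$ (i k, i (- k)))
        * (\<Prod>k\<in>{1..int n}. D k $$ (i (- k), i (?\<gamma> k)))" .
  qed
  finally show ?thesis .
qed

section \<open>The genus expansion\<close>

lemma glued_word_pi_hat:
  assumes \<epsilon>: "\<forall>k\<in>{1..int n}. \<epsilon> k \<in> {-1, 1}" and p: "p \<in> pairings_of {1..int n}"
    and n: "int n = part_end ns r"
  shows "glued_word n (gamma_plus ns r) (pi_hat \<epsilon> p)"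
    and "glued_word.K (gamma_plus ns r) (pi_hat \<epsilon> p) = kreweras_perm ns r \<epsilon> p"
proof -
  show g: "glued_word n (gamma_plus ns r) (pi_hat \<epsilon> p)"
    using gamma_plus_permutes[of ns r] pi_hat_props[OF \<epsilon> p] unfolding glued_word_def n[symmetric]
    by blast
  show "glued_word.K (gamma_plus ns r) (pi_hat \<epsilon> p) = kreweras_perm ns r \<epsilon> p"
    by (simp add: fun_eq_iff glued_word.K_def[OF g] kreweras_perm_eq)
qed

lemma monochromatic_iff_glued:
  assumes \<epsilon>: "\<forall>k\<in>{1..int n}. \<epsilon> k \<in> {-1, 1}" and p: "p \<in> pairings_of {1..int n}"
  shows "monochromatic (\<lambda>k. (i (delta' \<epsilon> k), i (- delta' \<epsilon> k))) p
    \<longleftrightarrow> (\<forall>x\<in>pm_interval n. i (pi_hat \<epsilon> p (- x)) = i x)"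
  unfolding monochromatic_iff[OF p]
proof (intro iffI ballI)
  fix x assume *: "\<forall>k\<in>{1..int n}. (i (delta' \<epsilon> (pairing_perm p k)), i (- delta' \<epsilon> (pairing_perm p k)))
      = (i (delta' \<epsilon> k), i (- delta' \<epsilon> k))" and x: "x \<in> pm_interval n"
  show "i (pi_hat \<epsilon> p (- x)) = i x"
  proof (rule delta'_cases[OF \<epsilon> x])
    fix k assume k: "k \<in> {1..int n}" "x = delta' \<epsilon> k"
    then show ?thesis using pi_hat_delta'[OF \<epsilon> p k(1)] * by simp
  next
    fix k assume k: "k \<in> {1..int n}" "x = - delta' \<epsilon> k"
    then show ?thesis using pi_hat_delta'[OF \<epsilon> p k(1)] * by simp
  qed
next
  fix k assume *: "\<forall>x\<in>pm_interval n. i (pi_hat \<epsilon> p (- x)) = i x" and k: "k \<in> {1..int n}"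
  have k': "\<bar>k\<bar> \<in> {1..int n}" using k by auto
  have "delta' \<epsilon> k \<in> pm_interval n" "- delta' \<epsilon> k \<in> pm_interval n"
    using delta'_props(1)[OF \<epsilon> k'] k' by (simp_all add: mem_pm_interval)
  then show "(i (delta' \<epsilon> (pairing_perm p k)), i (- delta' \<epsilon> (pairing_perm p k)))
      = (i (delta' \<epsilon> k), i (- delta' \<epsilon> k))"
    using pi_hat_delta'[OF \<epsilon> p k] bspec[OF *, of "delta' \<epsilon> k"] bspec[OF *, of "- delta' \<epsilon> k"]
    by simp
qed

lemma sqrt_power_normalisation:
  assumes "N > 0"
  shows "(1 / sqrt (real N)) ^ n / real N ^ r = real N powr (- real n / 2 - real r)"
proof -
  have "1 / sqrt (real N) = real N powr (- 1 / 2)"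
    using assms by (simp add: powr_half_sqrt[symmetric] powr_minus_divide[symmetric])
  then have "(1 / sqrt (real N)) ^ n = real N powr (- real n / 2)"
    using assms by (simp add: powr_powr powr_realpow[symmetric])
  moreover have "1 / real N ^ r = real N powr (- real r)"
    using assms by (simp add: powr_minus_divide powr_realpow)
  moreover have "real N powr (- real n / 2 - real r) = real N powr (- real n / 2) * real N powr (- real r)"
    by (simp flip: powr_add)
  ultimately show ?thesis
    by (metis times_divide_eq_right mult.right_neutral)
qed

theorem mainTheorem5:
  fixes P :: "'a measure"
    and f :: "nat \<Rightarrow> nat \<Rightarrow> 'a \<Rightarrow> real"
    and X :: "'a \<Rightarrow> real Matrix.mat"
    and r M N n :: nat
    and ns :: "nat \<Rightarrow> nat"
    and \<epsilon> :: "int \<Rightarrow> int"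
    and D :: "int \<Rightarrow> real Matrix.mat"
  assumes "prob_space P"
    and "r > 0" and "M > 0" and "N > 0"
    and "\<And>k. k \<in> {1..r} \<Longrightarrow> ns k > 0"
    and "n = (\<Sum>k=1..r. ns k)"
    and "\<And>k. k \<in> {1..int n} \<Longrightarrow> \<epsilon> k \<in> {-1, 1}"
    and "prob_space.indep_vars P (\<lambda>_. borel) (\<lambda>(i, j). f i j) ({..<M} \<times> {..<N})"
    and "\<And>i j. i < M \<Longrightarrow> j < N \<Longrightarrow> distributed P lborel (f i j) std_normal_density"
    and "X = gauss_mat M N f"
    and "\<And>k. k \<in> {1..int n} \<Longrightarrow>
           D k \<in> carrier_mat (signed_cols M N (\<epsilon> k)) (signed_rows M N (\<epsilon> (gamma_plus ns r k)))"
  shows "integrable P (\<lambda>\<omega>. \<Prod>k=1..r. word_trace N ns \<epsilon> D X k \<omega>) \<and>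
         prob_space.expectation P (\<lambda>\<omega>. \<Prod>k=1..r. word_trace N ns \<epsilon> D X k \<omega>) =
         real N powr (- real n / 2 - real r) *
         (\<Sum>p\<in>pairings n.
           trace_perm (half_dom n (kreweras_perm ns r \<epsilon> p))
             (half_perm n (kreweras_perm ns r \<epsilon> p)) D)"
proof -
  interpret prob_space P by fact
  note N = assms(4) and ns = assms(5) and X = assms(10)
  have \<epsilon>: "\<forall>k\<in>{1..int n}. \<epsilon> k \<in> {-1, 1}"
    using assms(7) by blast
  have n: "int n = part_end ns r"
    using assms(6) by (simp add: part_end_def)
  let ?\<gamma> = "gamma_plus ns r" and ?Q = "pm_interval n"
  have \<gamma>_in: "?\<gamma> k \<in> {1..int n}" if "k \<in> {1..int n}" for k
    using permutes_in_image[OF gamma_plus_permutes[of ns r]] that n by auto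
  \<comment> \<open>Row indices of \<open>X\<close> sit at the positions \<open>x\<close> with \<open>\<delta>' x > 0\<close>, column indices at the others.\<close>
  define d where "d x = (if delta' \<epsilon> x > 0 then M else N)" for x
  have d_pos: "d k = signed_rows M N (\<epsilon> k)" and d_neg: "d (- k) = signed_cols M N (\<epsilon> k)"
    if "k \<in> {1..int n}" for k
    using bspec[OF \<epsilon> that] that by (auto simp: d_def delta'_def signed_rows_def signed_cols_def)
  have d_delta': "d (delta' \<epsilon> k) = M" "d (- delta' \<epsilon> k) = N"
      "delta' \<epsilon> k \<in> ?Q" "- delta' \<epsilon> k \<in> ?Q" if k: "k \<in> {1..int n}" for k
  proof -
    have k': "\<bar>k\<bar> \<in> {1..int n}" using k by auto
    note dk = delta'_props[OF \<epsilon> k']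
    show Q: "delta' \<epsilon> k \<in> ?Q" "- delta' \<epsilon> k \<in> ?Q"
      using dk(1) k' by (simp_all add: mem_pm_interval)
    have "delta' \<epsilon> (- delta' \<epsilon> k) = - k"
      using delta'_props(3)[OF \<epsilon>, of "delta' \<epsilon> k"] dk(1,2) k' by simp
    then show "d (delta' \<epsilon> k) = M" "d (- delta' \<epsilon> k) = N"
      using dk(2) k by (simp_all add: d_def)
  qed
  have D: "D k \<in> carrier_mat (d (- k)) (d (?\<gamma> k))" if "k \<in> {1..int n}" for k
    using assms(11)[OF that] d_neg[OF that] d_pos[OF \<gamma>_in[OF that]] by simp
  define J where "J = PiE ?Q (\<lambda>x. {..<d x})"
  have J: "finite J"
    unfolding J_def by (intro finite_PiE) (auto simp: pm_interval_def)
  define W where "W i = (\<Prod>k\<in>{1..int n}. D k $$ (i (- k), i (?\<gamma> k)))" for i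
  \<comment> \<open>The entry of \<open>X\<close> selected by the \<open>k\<close>-th factor, whether or not that factor is transposed.\<close>
  define a where "a i k = (i (delta' \<epsilon> k), i (- delta' \<epsilon> k))" for i :: "int \<Rightarrow> nat" and k
  define g where "g = (\<lambda>(u, v). f u v)"
  define G where "G i \<omega> = (\<Prod>k\<in>{1..int n}. g (a i k) \<omega>)" for i \<omega>
  let ?c = "(1 / sqrt (real N)) ^ n / real N ^ r"

  have X_entries: "(\<Prod>k\<in>{1..int n}. signed_mat (X \<omega>) (\<epsilon> k) $$ (i k, i (- k)))
      = (1 / sqrt (real N)) ^ n * G i \<omega>" if i: "i \<in> J" for i \<omega>
  proof -
    have "signed_mat (X \<omega>) (\<epsilon> k) $$ (i k, i (- k)) = 1 / sqrt (real N) * g (a i k) \<omega>"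
      if k: "k \<in> {1..int n}" for k
    proof -
      have "k \<in> ?Q" "- k \<in> ?Q" using k by (auto simp: pm_interval_def)
      then have "i k < d k" "i (- k) < d (- k)"
        using i by (auto simp: J_def)
      then show ?thesis
        using bspec[OF \<epsilon> k] k d_pos[OF k] d_neg[OF k]
        by (auto simp: X gauss_mat_def signed_mat_def signed_rows_def signed_cols_def
            a_def g_def delta'_def)
    qed
    then show ?thesis
      by (simp add: G_def prod_dividef power_one_over)
  qed
  have expand: "(\<Prod>k=1..r. word_trace N ns \<epsilon> D X k \<omega>) = (\<Sum>i\<in>J. ?c * W i * G i \<omega>)" for \<omega>
  proof -
    have "signed_mat (X \<omega>) (\<epsilon> k) \<in> carrier_mat (d k) (d (- k))" if "k \<in> {1..int n}" for k
      unfolding d_pos[OF that] d_neg[OF that]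
      by (rule signed_mat_dims) (simp add: X gauss_mat_def)
    note word_traces_expand[OF ns n this D]
    then have "(\<Prod>k=1..r. word_trace N ns \<epsilon> D X k \<omega>)
      = (\<Sum>i\<in>J. (\<Prod>k\<in>{1..int n}. signed_mat (X \<omega>) (\<epsilon> k) $$ (i k, i (- k))) * W i) / real N ^ r"
      by (simp add: word_trace_def norm_trace_def prod_dividef J_def W_def)
    also have "\<dots> = (\<Sum>i\<in>J. ?c * W i * G i \<omega>)"
      unfolding sum_divide_distrib by (intro sum.cong refl) (simp add: X_entries)
    finally show ?thesis .
  qed

  have G: "integrable P (G i)"
    "expectation (G i) = (\<Sum>p\<in>pairings n. of_bool (monochromatic (a i) p))" if i: "i \<in> J" for i
  proof -
    have im: "a i ` {1..int n} \<subseteq> {..<M} \<times> {..<N}"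
      using i d_delta' by (fastforce simp: a_def J_def PiE_def Pi_def)
    have ind: "indep_vars (\<lambda>_. borel) g ({..<M} \<times> {..<N})"
      using assms(8) by (simp add: g_def)
    have "distributed P lborel (g v) std_normal_density" if "v \<in> {..<M} \<times> {..<N}" for v
      using assms(9) that by (auto simp: g_def)
    note wick = gaussian_wick[OF _ ind this _ im]
    show "integrable P (G i)"
      unfolding G_def by (rule wick(1)) simp_all
    show "expectation (G i) = (\<Sum>p\<in>pairings n. of_bool (monochromatic (a i) p))"
      unfolding G_def using wick(2) by (simp add: pairings_def pairings_of_def)
  qed

  have trace: "(\<Sum>i\<in>J. W i * of_bool (monochromatic (a i) p))
      = trace_perm (half_dom n (kreweras_perm ns r \<epsilon> p)) (half_perm n (kreweras_perm ns r \<epsilon> p)) D"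
    if "p \<in> pairings n" for p
  proof -
    have p: "p \<in> pairings_of {1..int n}"
      using that by (simp add: pairings_def pairings_of_def)
    note gw = glued_word_pi_hat[OF \<epsilon> p n]
    have d_glue: "d (pi_hat \<epsilon> p (- x)) = d x" if x: "x \<in> ?Q" for x
    proof -
      have x': "- x \<in> ?Q" "\<bar>x\<bar> \<in> {1..int n}" using x by (simp_all add: mem_pm_interval)
      then show ?thesis
        using pi_hat_props(5)[OF \<epsilon> p x'(1)] delta'_props(3)[OF \<epsilon> x'(2)] by (simp add: d_def)
    qed
    have "(\<Sum>i\<in>J. W i * of_bool (monochromatic (a i) p)) = (\<Sum>i | i \<in> J \<and> monochromatic (a i) p. W i)"
      using J by (intro sum.mono_neutral_cong_right) auto
    also have "{i. i \<in> J \<and> monochromatic (a i) p}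
        = {i. i \<in> PiE ?Q (\<lambda>x. {..<d x}) \<and> (\<forall>x\<in>?Q. i (pi_hat \<epsilon> p (- x)) = i x)}"
      unfolding a_def monochromatic_iff_glued[OF \<epsilon> p] J_def ..
    also have "(\<Sum>i | i \<in> PiE ?Q (\<lambda>x. {..<d x}) \<and> (\<forall>x\<in>?Q. i (pi_hat \<epsilon> p (- x)) = i x). W i)
        = trace_perm (half_dom n (kreweras_perm ns r \<epsilon> p)) (half_perm n (kreweras_perm ns r \<epsilon> p)) D"
      unfolding W_def gw(2)[symmetric] using d_glue D
      by (intro glued_word.trace_half[OF gw(1), symmetric]) blast+
    finally show ?thesis .
  qed

  have int: "integrable P (\<lambda>\<omega>. \<Prod>k=1..r. word_trace N ns \<epsilon> D X k \<omega>)"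
    unfolding expand using G(1) by (intro Bochner_Integration.integrable_sum integrable_mult_right) auto
  have "expectation (\<lambda>\<omega>. \<Prod>k=1..r. word_trace N ns \<epsilon> D X k \<omega>) = (\<Sum>i\<in>J. ?c * W i * expectation (G i))"
    unfolding expand using G(1) by (subst Bochner_Integration.integral_sum) auto
  also have "\<dots> = (\<Sum>i\<in>J. \<Sum>p\<in>pairings n. ?c * (W i * of_bool (monochromatic (a i) p)))"
    by (intro sum.cong refl) (simp add: G(2) sum_distrib_left mult.assoc)
  also have "\<dots> = ?c * (\<Sum>p\<in>pairings n. \<Sum>i\<in>J. W i * of_bool (monochromatic (a i) p))"
    by (subst sum.swap) (simp add: sum_distrib_left)
  also have "\<dots> = ?c * (\<Sum>p\<in>pairings n.
      trace_perm (half_dom n (kreweras_perm ns r \<epsilon> p)) (half_perm n (kreweras_perm ns r \<epsilon> p)) D)"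
    using trace by simp
  finally show ?thesis
    using int unfolding sqrt_power_normalisation[OF N] by blast
qed

end
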